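(* Let $d\in\{2,3\}$, $\Omega$, $\boldsymbol U_N$, $\boldsymbol W_N$ be as in the context, let $\nu,\eta,\mu,\rho,\tau>0$ and $k\in\{1,2\}$. Let $n\ge k-1$ and suppose $\boldsymbol u^{n+1-j}\in\boldsymbol U_N$, $\boldsymbol B^{n+1-j}\in\boldsymbol W_N$ for $j=1,\dots,k$, and that $(\boldsymbol u^{n+1},\boldsymbol B^{n+1})\in\boldsymbol U_N\times\boldsymbol W_N$ satisfies, for all $(\boldsymbol\chi,\boldsymbol\Phi)\in\boldsymbol U_N\times\boldsymbol W_N$, $$\tfrac1\tau(\gamma\boldsymbol u^{n+1}-\hat{\boldsymbol u},\boldsymbol\chi)+(\tilde{\boldsymbol u}^{n+1}\cdot\nabla\boldsymbol u^{n+1},\boldsymbol\chi)+\nu(\nabla\boldsymbol u^{n+1},\nabla\boldsymbol\chi)=\tfrac{1}{\mu\rho}\big((\nabla\times\boldsymbol B^{n+1})\times\tilde{\boldsymbol B}^{n+1},\boldsymbol\chi\big)+(\boldsymbol f^{n+1},\boldsymbol\chi),$$ $$\tfrac1\tau(\gamma\boldsymbol B^{n+1}-\hat{\boldsymbol B},\boldsymbol\Phi)+\eta(\nabla\times\boldsymbol B^{n+1},\nabla\times\boldsymbol\Phi)-\big(\nabla\times(\boldsymbol u^{n+1}\times\tilde{\boldsymbol B}^{n+1}),\boldsymbol\Phi\big)=0,$$ with $\boldsymbol f^{n+1}=\boldsymbol 0$. Then $$\mathcal E^{n+1}-\mathcal E^n=-\mathcal D^{n+1}-\nu\|\nabla\boldsymbol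 u^{n+1}\|^2-\frac{\eta}{\mu\rho}\|\nabla\times\boldsymbol B^{n+1}\|^2,$$ where for $k=1$: $\mathcal E^n=\frac1{2\tau}\big(\|\boldsymbol u^n\|^2+\frac1{\mu\rho}\|\boldsymbol B^n\|^2\big)$, $\mathcal D^{n+1}=\frac1{2\tau}\big(\|\boldsymbol u^{n+1}-\boldsymbol u^n\|^2+\frac1{\mu\rho}\|\boldsymbol B^{n+1}-\boldsymbol B^n\|^2\big)$; and for $k=2$: $\mathcal E^n=\frac1{4\tau}\big(\|\boldsymbol u^n\|^2+\|2\boldsymbol u^n-\boldsymbol u^{n-1}\|^2+\frac1{\mu\rho}\|\boldsymbol B^n\|^2+\frac1{\mu\rho}\|2\boldsymbol B^n-\boldsymbol B^{n-1}\|^2\big)$, $\mathcal D^{n+1}=\frac1{4\tau}\big(\|\boldsymbol u^{n+1}-2\boldsymbol u^n+\boldsymbol u^{n-1}\|^2+\frac1{\mu\rho}\|\boldsymbol B^{n+1}-2\boldsymbol B^n+\boldsymbol B^{n-1}\|^2\big)$.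
   Context: $\|\cdot\|$ and $(\cdot,\cdot)$ are the $L^2(\Omega)$ norm and inner product. For $k=1$: $\gamma=1$, $\hat\chi=\chi^n$, $\tilde\chi^{n+1}=\chi^n$; for $k=2$: $\gamma=3/2$, $\hat\chi=2\chi^n-\frac12\chi^{n-1}$, $\tilde\chi^{n+1}=2\chi^n-\chi^{n-1}$ (applied to $\boldsymbol u$ and $\boldsymbol B$). $\Lambda=(-1,1)$, $\Omega=\mathcal F(\Lambda^d)$ with $\mathcal F$ a diffeomorphism of $[-1,1]^d$ onto $\overline\Omega$; $\mathcal F^{\rm div}[\boldsymbol\Phi](\boldsymbol x)=\frac{\partial_{\boldsymbol\xi}\boldsymbol x}{\det\partial_{\boldsymbol\xi}\boldsymbol x}\boldsymbol\Phi(\mathcal F^{-1}(\boldsymbol x))$ (Jacobian of $\mathcal F$). One-dimensional functions: $L_n$ Legendre; $P_n^{(-1,-1)}(\xi)=\frac{\xi^2-1}{4}P_{n-2}^{(1,1)}(\xi)$ ($n\ge2$), $P_n^{(-2,-2)}(\xi)=(\frac{\xi^2-1}{4})^2P_{n-4}^{(2,2)}(\xi)$ ($n\ge4$), $P^{(\alpha,\beta)}$ classical Jacobi; $\psi_m=\frac{\sqrt{2(2m-1)}}{m-1}P_m^{(-1,-1)}$, $\phi_n=\sqrt{\frac{2n+1}{2}}L_n$, $\varphi_m=\frac{\sqrt{8(2m-3)}}{(m-3)(m-2)}P_m^{(-2,-2)}$. Spaces ($N\ge4$): for $d=2$, $\boldsymbol W_N=\mathrm{span}\{\mathcal F^{\rm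 div}[(\psi_{m+1}(\xi_1)\phi_n(\xi_2),-\phi_m(\xi_1)\psi_{n+1}(\xi_2))^\intercal]\}_{m,n=1}^{N-1}$ and $\boldsymbol U_N=\mathrm{span}\{\mathcal F^{\rm div}[(\varphi_{m+3}(\xi_1)\psi_{n+2}(\xi_2),-\psi_{m+2}(\xi_1)\varphi_{n+3}(\xi_2))^\intercal]\}_{m,n=1}^{N-3}$. For $d=3$, $\boldsymbol W_N$ is the span over $m,n,l=1,\dots,N-1$ of the Piola images of $(\psi_{m+1}\phi_n\phi_l,-\phi_m\psi_{n+1}\phi_l,0)$, $(\psi_{m+1}\phi_n\phi_l,0,-\phi_m\phi_n\psi_{l+1})$, $(0,\psi_{n+1}(\xi_2)\phi_l(\xi_3),-\phi_n(\xi_2)\psi_{l+1}(\xi_3))$, $(\psi_{m+1}(\xi_1)\phi_l(\xi_3),0,-\phi_m(\xi_1)\psi_{l+1}(\xi_3))$, $(\psi_{m+1}(\xi_1)\phi_n(\xi_2),-\phi_m(\xi_1)\psi_{n+1}(\xi_2),0)$ (in triple products the factors are functions of $\xi_1,\xi_2,\xi_3$ in order); $\boldsymbol U_N$ is the span over $m,n,l=1,\dots,N-3$ of the Piola images of $(\varphi_{m+3}\psi_{n+2}\psi_{l+2},-\psi_{m+2}\varphi_{n+3}\psi_{l+2},0)$, $(\varphi_{m+3}\psi_{n+2}\psi_{l+2},0,-\psi_{m+2}\psi_{n+2}\varphi_{l+3})$, $(0,\psi_2\varphi_{n+3}\psi_{l+2},-\psi_2\psi_{n+2}\varphi_{l+3})$,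 $(\varphi_{m+3}\psi_2\psi_{l+2},0,-\psi_{m+2}\psi_2\varphi_{l+3})$, $(\varphi_{m+3}\psi_{n+2}\psi_2,-\psi_{m+2}\varphi_{n+3}\psi_2,0)$. In 2D, for vectors $\boldsymbol a,\boldsymbol b$ and scalar $c$: $\nabla\times\boldsymbol v=\partial_1v_2-\partial_2v_1$, $\nabla\times c=(\partial_2c,-\partial_1c)^\intercal$, $\boldsymbol a\times\boldsymbol b=a_1b_2-a_2b_1$, $c\times\boldsymbol b=(-cb_2,cb_1)^\intercal$. *)

theory Defs
  imports "HOL-Analysis.Analysis"
begin

text \<open>Classical Jacobi polynomials with integer parameters a, b (explicit sum formula,
  DLMF 18.5.8).\<close>
definition jacobiP :: "nat \<Rightarrow> nat \<Rightarrow> nat \<Rightarrow> real \<Rightarrow> real" where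
  "jacobiP a b n x = (\<Sum>s=0..n. real ((n + a) choose (n - s)) * real ((n + b) choose s)
       * ((x - 1) / 2) ^ s * ((x + 1) / 2) ^ (n - s))"

definition legendre :: "nat \<Rightarrow> real \<Rightarrow> real" where
  "legendre n x = jacobiP 0 0 n x"

text \<open>Generalized Jacobi polynomials P_n^(-1,-1) (n >= 2) and P_n^(-2,-2) (n >= 4).\<close>
definition jacobiM1 :: "nat \<Rightarrow> real \<Rightarrow> real" where
  "jacobiM1 n x = (x^2 - 1) / 4 * jacobiP 1 1 (n - 2) x"

definition jacobiM2 :: "nat \<Rightarrow> real \<Rightarrow> real" where
  "jacobiM2 n x = ((x^2 - 1) / 4)^2 * jacobiP 2 2 (n - 4) x"

definition psi :: "nat \<Rightarrow> real \<Rightarrow> real" where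
  "psi m x = sqrt (2 * (2 * real m - 1)) / (real m - 1) * jacobiM1 m x"

definition phi :: "nat \<Rightarrow> real \<Rightarrow> real" where
  "phi n x = sqrt ((2 * real n + 1) / 2) * legendre n x"

definition vphi :: "nat \<Rightarrow> real \<Rightarrow> real" where
  "vphi m x = sqrt (8 * (2 * real m - 3)) / ((real m - 3) * (real m - 2)) * jacobiM2 m x"

definition pd :: "'n::finite \<Rightarrow> (real^'n \<Rightarrow> 'b::real_normed_vector) \<Rightarrow> real^'n \<Rightarrow> 'b" where
  "pd j f x = frechet_derivative f (at x) (axis j 1)"

fun Ck_on :: "nat \<Rightarrow> (real^'n::finite) set \<Rightarrow> (real^'n \<Rightarrow> 'b::real_normed_vector) \<Rightarrow> bool" where
  "Ck_on 0 S f = continuous_on S f"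
| "Ck_on (Suc k) S f = (f differentiable_on S \<and> (\<forall>j. Ck_on k S (pd j f)))"

definition ref_cube :: "(real^'n::finite) set" where
  "ref_cube = cbox (vec (-1)) (vec 1)"

definition ref_open_cube :: "(real^'n::finite) set" where
  "ref_open_cube = box (vec (-1)) (vec 1)"

definition jac :: "(real^'n::finite \<Rightarrow> real^'n) \<Rightarrow> real^'n \<Rightarrow> real^'n^'n" where
  "jac F \<xi> = matrix (frechet_derivative F (at \<xi>))"

definition smooth_diffeo_cube :: "(real^'n::finite \<Rightarrow> real^'n) \<Rightarrow> bool" where
  "smooth_diffeo_cube F \<longleftrightarrow>
     (\<exists>S. open S \<and> ref_cube \<subseteq> S \<and> (\<forall>k. Ck_on k S F)) \<and>
     inj_on F ref_cube \<and> (\<forall>\<xi>\<in>ref_cube. det (jac F \<xi>) \<noteq> 0)"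

definition dom_of :: "(real^'n::finite \<Rightarrow> real^'n) \<Rightarrow> (real^'n) set" where
  "dom_of F = F ` ref_open_cube"

definition piola :: "(real^'n::finite \<Rightarrow> real^'n) \<Rightarrow> (real^'n \<Rightarrow> real^'n) \<Rightarrow> real^'n \<Rightarrow> real^'n" where
  "piola F \<Phi> x = (let \<xi> = inv_into ref_cube F x
                   in (1 / det (jac F \<xi>)) *\<^sub>R (jac F \<xi> *v \<Phi> \<xi>))"

definition fspan :: "('a \<Rightarrow> 'b::real_vector) set \<Rightarrow> ('a \<Rightarrow> 'b) set" where
  "fspan S = {v. \<exists>c. v = (\<lambda>x. \<Sum>b\<in>S. c b *\<^sub>R b x)}"

definition W2 :: "(real^2 \<Rightarrow> real^2) \<Rightarrow> nat \<Rightarrow> (real^2 \<Rightarrow> real^2) set" where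
  "W2 F N = fspan {piola F (\<lambda>\<xi>. vector [psi (m+1) (\<xi>$1) * phi n (\<xi>$2),
                                          - phi m (\<xi>$1) * psi (n+1) (\<xi>$2)]) | m n.
                   m \<in> {1..N-1} \<and> n \<in> {1..N-1}}"

definition U2 :: "(real^2 \<Rightarrow> real^2) \<Rightarrow> nat \<Rightarrow> (real^2 \<Rightarrow> real^2) set" where
  "U2 F N = fspan {piola F (\<lambda>\<xi>. vector [vphi (m+3) (\<xi>$1) * psi (n+2) (\<xi>$2),
                                          - psi (m+2) (\<xi>$1) * vphi (n+3) (\<xi>$2)]) | m n.
                   m \<in> {1..N-3} \<and> n \<in> {1..N-3}}"

definition W3 :: "(real^3 \<Rightarrow> real^3) \<Rightarrow> nat \<Rightarrow> (real^3 \<Rightarrow> real^3) set" where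
  "W3 F N = fspan (\<Union>m\<in>{1..N-1}. \<Union>n\<in>{1..N-1}. \<Union>l\<in>{1..N-1}. piola F ` {
     (\<lambda>\<xi>. vector [psi (m+1) (\<xi>$1) * phi n (\<xi>$2) * phi l (\<xi>$3),
                  - phi m (\<xi>$1) * psi (n+1) (\<xi>$2) * phi l (\<xi>$3), 0]),
     (\<lambda>\<xi>. vector [psi (m+1) (\<xi>$1) * phi n (\<xi>$2) * phi l (\<xi>$3), 0,
                  - phi m (\<xi>$1) * phi n (\<xi>$2) * psi (l+1) (\<xi>$3)]),
     (\<lambda>\<xi>. vector [0, psi (n+1) (\<xi>$2) * phi l (\<xi>$3), - phi n (\<xi>$2) * psi (l+1) (\<xi>$3)]),
     (\<lambda>\<xi>. vector [psi (m+1) (\<xi>$1) * phi l (\<xi>$3), 0, - phi m (\<xi>$1) * psi (l+1) (\<xi>$3)]),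
     (\<lambda>\<xi>. vector [psi (m+1) (\<xi>$1) * phi n (\<xi>$2), - phi m (\<xi>$1) * psi (n+1) (\<xi>$2), 0])})"

definition U3 :: "(real^3 \<Rightarrow> real^3) \<Rightarrow> nat \<Rightarrow> (real^3 \<Rightarrow> real^3) set" where
  "U3 F N = fspan (\<Union>m\<in>{1..N-3}. \<Union>n\<in>{1..N-3}. \<Union>l\<in>{1..N-3}. piola F ` {
     (\<lambda>\<xi>. vector [vphi (m+3) (\<xi>$1) * psi (n+2) (\<xi>$2) * psi (l+2) (\<xi>$3),
                  - psi (m+2) (\<xi>$1) * vphi (n+3) (\<xi>$2) * psi (l+2) (\<xi>$3), 0]),
     (\<lambda>\<xi>. vector [vphi (m+3) (\<xi>$1) * psi (n+2) (\<xi>$2) * psi (l+2) (\<xi>$3), 0,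
                  - psi (m+2) (\<xi>$1) * psi (n+2) (\<xi>$2) * vphi (l+3) (\<xi>$3)]),
     (\<lambda>\<xi>. vector [0, psi 2 (\<xi>$1) * vphi (n+3) (\<xi>$2) * psi (l+2) (\<xi>$3),
                  - psi 2 (\<xi>$1) * psi (n+2) (\<xi>$2) * vphi (l+3) (\<xi>$3)]),
     (\<lambda>\<xi>. vector [vphi (m+3) (\<xi>$1) * psi 2 (\<xi>$2) * psi (l+2) (\<xi>$3), 0,
                  - psi (m+2) (\<xi>$1) * psi 2 (\<xi>$2) * vphi (l+3) (\<xi>$3)]),
     (\<lambda>\<xi>. vector [vphi (m+3) (\<xi>$1) * psi (n+2) (\<xi>$2) * psi 2 (\<xi>$3),
                  - psi (m+2) (\<xi>$1) * vphi (n+3) (\<xi>$2) * psi 2 (\<xi>$3), 0])})"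

definition L2ip :: "(real^'n::finite) set \<Rightarrow> (real^'n \<Rightarrow> 'b::real_inner) \<Rightarrow> (real^'n \<Rightarrow> 'b) \<Rightarrow> real" where
  "L2ip \<Omega> f g = integral \<Omega> (\<lambda>x. f x \<bullet> g x)"

definition L2sq :: "(real^'n::finite) set \<Rightarrow> (real^'n \<Rightarrow> 'b::real_inner) \<Rightarrow> real" where
  "L2sq \<Omega> f = L2ip \<Omega> f f"

definition grad_ip :: "(real^'n::finite) set \<Rightarrow> (real^'n \<Rightarrow> real^'n) \<Rightarrow> (real^'n \<Rightarrow> real^'n) \<Rightarrow> real" where
  "grad_ip \<Omega> u v = (\<Sum>i\<in>UNIV. \<Sum>j\<in>UNIV. L2ip \<Omega> (pd j (\<lambda>y. u y $ i)) (pd j (\<lambda>y. v y $ i)))"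

definition conv :: "(real^'n::finite \<Rightarrow> real^'n) \<Rightarrow> (real^'n \<Rightarrow> real^'n) \<Rightarrow> real^'n \<Rightarrow> real^'n" where
  "conv w u x = (\<chi> i. \<Sum>j\<in>UNIV. w x $ j * pd j (\<lambda>y. u y $ i) x)"

definition curl2v :: "(real^2 \<Rightarrow> real^2) \<Rightarrow> real^2 \<Rightarrow> real" where
  "curl2v v x = pd 1 (\<lambda>y. v y $ 2) x - pd 2 (\<lambda>y. v y $ 1) x"

definition curl2s :: "(real^2 \<Rightarrow> real) \<Rightarrow> real^2 \<Rightarrow> real^2" where
  "curl2s c x = vector [pd 2 c x, - pd 1 c x]"

definition cross2vv :: "real^2 \<Rightarrow> real^2 \<Rightarrow> real" where
  "cross2vv a b = a$1 * b$2 - a$2 * b$1"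

definition cross2sv :: "real \<Rightarrow> real^2 \<Rightarrow> real^2" where
  "cross2sv c b = vector [- c * b$2, c * b$1]"

definition curl3 :: "(real^3 \<Rightarrow> real^3) \<Rightarrow> real^3 \<Rightarrow> real^3" where
  "curl3 v x = vector [pd 2 (\<lambda>y. v y $ 3) x - pd 3 (\<lambda>y. v y $ 2) x,
                       pd 3 (\<lambda>y. v y $ 1) x - pd 1 (\<lambda>y. v y $ 3) x,
                       pd 1 (\<lambda>y. v y $ 2) x - pd 2 (\<lambda>y. v y $ 1) x]"

definition bdf_gamma :: "nat \<Rightarrow> real" where
  "bdf_gamma k = (if k = 1 then 1 else 3 / 2)"

text \<open>hat(chi) used at step n+1.\<close>
definition bdf_hat :: "nat \<Rightarrow> (nat \<Rightarrow> 'a \<Rightarrow> 'b::real_vector) \<Rightarrow> nat \<Rightarrow> 'a \<Rightarrow> 'b" where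
  "bdf_hat k w n = (if k = 1 then w n else (\<lambda>x. 2 *\<^sub>R w n x - (1/2) *\<^sub>R w (n - 1) x))"

definition bdf_tilde :: "nat \<Rightarrow> (nat \<Rightarrow> 'a \<Rightarrow> 'b::real_vector) \<Rightarrow> nat \<Rightarrow> 'a \<Rightarrow> 'b" where
  "bdf_tilde k w n = (if k = 1 then w n else (\<lambda>x. 2 *\<^sub>R w n x - w (n - 1) x))"

definition energy :: "(real^'n::finite) set \<Rightarrow> nat \<Rightarrow> real \<Rightarrow> real \<Rightarrow> real \<Rightarrow>
    (nat \<Rightarrow> real^'n \<Rightarrow> real^'n) \<Rightarrow> (nat \<Rightarrow> real^'n \<Rightarrow> real^'n) \<Rightarrow> nat \<Rightarrow> real" where
  "energy \<Omega> k \<tau> \<mu> \<rho> u B m =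
    (if k = 1 then 1 / (2 * \<tau>) * (L2sq \<Omega> (u m) + 1 / (\<mu> * \<rho>) * L2sq \<Omega> (B m))
     else 1 / (4 * \<tau>) * (L2sq \<Omega> (u m) + L2sq \<Omega> (\<lambda>x. 2 *\<^sub>R u m x - u (m - 1) x)
            + 1 / (\<mu> * \<rho>) * L2sq \<Omega> (B m)
            + 1 / (\<mu> * \<rho>) * L2sq \<Omega> (\<lambda>x. 2 *\<^sub>R B m x - B (m - 1) x)))"

definition dissip :: "(real^'n::finite) set \<Rightarrow> nat \<Rightarrow> real \<Rightarrow> real \<Rightarrow> real \<Rightarrow>
    (nat \<Rightarrow> real^'n \<Rightarrow> real^'n) \<Rightarrow> (nat \<Rightarrow> real^'n \<Rightarrow> real^'n) \<Rightarrow> nat \<Rightarrow> real" where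
  "dissip \<Omega> k \<tau> \<mu> \<rho> u B m =
    (if k = 1 then 1 / (2 * \<tau>) * (L2sq \<Omega> (\<lambda>x. u m x - u (m - 1) x)
                                  + 1 / (\<mu> * \<rho>) * L2sq \<Omega> (\<lambda>x. B m x - B (m - 1) x))
     else 1 / (4 * \<tau>) * (L2sq \<Omega> (\<lambda>x. u m x - 2 *\<^sub>R u (m - 1) x + u (m - 2) x)
            + 1 / (\<mu> * \<rho>) * L2sq \<Omega> (\<lambda>x. B m x - 2 *\<^sub>R B (m - 1) x + B (m - 2) x)))"

end

theory Submission
  imports Defs
begin

text \<open>
  Testing the momentum equation with \<open>u (n + 1)\<close> and the induction equation with \<open>B (n + 1)\<close>, the
  time differences become the energy and dissipation terms by the polarization identities of BDF1
  and BDF2. The Lorentz and induction terms cancel after integrating the curl by parts, because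
  \<open>u \<times> B\<close> vanishes on the boundary. The convective term is \<open>w \<cdot> \<nabla>(|u|\<^sup>2 / 2)\<close>; pulled back to the
  cube it becomes \<open>\<plusminus> \<Phi> \<cdot> \<nabla>q\<close> for the reference field \<open>\<Phi>\<close> of \<open>w\<close>, which is divergence free
  because the derivative of \<open>vphi (m + 3)\<close> is \<open>psi (m + 2)\<close>.

  Integration by parts on the curved domain rests on one fact: if \<open>f\<close> is \<open>C\<^sup>1\<close> with bounded partial
  derivatives and tends to 0 at a negligible boundary, its extension by 0 is Lipschitz along lines,
  its difference quotients have integral 0 by translation invariance, and dominated convergence
  gives integral 0 for the partial derivatives.
\<close>

section \<open>Bounded functions with bounded continuous partial derivatives\<close>

text \<open>A physical field is a composition with the inverse of \<open>F\<close>, whose values off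
  the image of the closed cube are arbitrary. Differentiability is therefore available only in the
  open domain, and boundary values are stated as limits from inside. The only regularity used of the
  curved boundary is that it is negligible.

  The Lorentz and induction terms contain the same extrapolated field
  \<open>bdf_tilde k B n\<close>. After integration by parts both are multiples of one integral, and
  the weight \<open>1 / (\<mu> * \<rho>)\<close> of the magnetic energy is the one for which they
  cancel. The velocity alone supplies the vanishing boundary factor, both there and in the
  convective term; on the magnetic side only bounded first partials enter.

  The extrapolated velocity is a linear combination of members of the velocity space, so it inherits
  zero divergence and zero boundary values exactly. Hence the convective term vanishes for the
  discrete solution itself, with no consistency error and no skew-symmetrized form.\<close>

lemma pd_eqI: "(f has_derivative f') (at x) \<Longrightarrow> pd j f x = f' (axis j 1)"
  unfolding pd_def by (metis frechet_derivative_at)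

lemmas has_frechet_derivative = frechet_derivative_works [THEN iffD1]

lemma has_derivative_pd:
  "f differentiable at x \<Longrightarrow> (f has_derivative (\<lambda>h. \<Sum>j\<in>UNIV. (h $ j) *\<^sub>R pd j f x)) (at x)"
proof -
  assume "f differentiable at x"
  then have D: "(f has_derivative frechet_derivative f (at x)) (at x)"
    using frechet_derivative_works by blast
  then have L: "linear (frechet_derivative f (at x))"
    using has_derivative_bounded_linear bounded_linear.linear by blast
  have "frechet_derivative f (at x) h = (\<Sum>j\<in>UNIV. (h $ j) *\<^sub>R pd j f x)" for h
  proof -
    have "frechet_derivative f (at x) h = frechet_derivative f (at x) (\<Sum>j\<in>UNIV. h $ j *\<^sub>R axis j 1)"
      using basis_expansion [of h] by (simp add: scalar_mult_eq_scaleR)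
    then show ?thesis
      using L by (simp add: pd_def linear_sum linear_scale)
  qed
  then show ?thesis
    using D by (metis (no_types, lifting) ext)
qed

section \<open>Rules for partial derivatives\<close>

lemma pd_const: "pd j (\<lambda>x. c) x = 0"
  by (rule pd_eqI [of _ "\<lambda>h. 0", simplified]) simp

lemma pd_add:
  assumes "f differentiable at x" "g differentiable at x"
  shows "pd j (\<lambda>x. f x + g x) x = pd j f x + pd j g x"
  using pd_eqI [OF has_derivative_add [OF assms [THEN has_frechet_derivative]]] by (simp add: pd_def)

lemma pd_sum:
  assumes "\<And>i. i \<in> I \<Longrightarrow> f i differentiable at x"
  shows "pd j (\<lambda>x. \<Sum>i\<in>I. f i x) x = (\<Sum>i\<in>I. pd j (f i) x)"
proof -
  have "((\<lambda>x. \<Sum>i\<in>I. f i x) has_derivative (\<lambda>h. \<Sum>i\<in>I. frechet_derivative (f i) (at x) h)) (at x)"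
    using assms by (intro has_derivative_sum has_frechet_derivative)
  from pd_eqI [OF this] show ?thesis
    by (simp add: pd_def)
qed

lemma pd_mult:
  fixes f g :: "real^'n::finite \<Rightarrow> real"
  assumes "f differentiable at x" "g differentiable at x"
  shows "pd j (\<lambda>x. f x * g x) x = f x * pd j g x + pd j f x * g x"
  using pd_eqI [OF has_derivative_mult [OF assms [THEN has_frechet_derivative]]] by (simp add: pd_def)

lemma pd_inverse:
  fixes f :: "real^'n::finite \<Rightarrow> real"
  assumes "f differentiable at x" "f x \<noteq> 0"
  shows "pd j (\<lambda>x. inverse (f x)) x = - (inverse (f x) * pd j f x * inverse (f x))"
  using pd_eqI [OF Deriv.has_derivative_inverse [OF assms(2) has_frechet_derivative [OF assms(1)]]]
  by (simp add: pd_def)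

lemma pd_component:
  assumes "f differentiable at x"
  shows "(\<lambda>y. f y $ i) differentiable at x" "pd j (\<lambda>y. f y $ i) x = pd j f x $ i"
proof -
  have "((\<lambda>y. f y $ i) has_derivative (\<lambda>h. frechet_derivative f (at x) h $ i)) (at x)"
    using assms bounded_linear.has_derivative [OF bounded_linear_vec_nth] frechet_derivative_works by blast
  then show "(\<lambda>y. f y $ i) differentiable at x" "pd j (\<lambda>y. f y $ i) x = pd j f x $ i"
    by (auto simp: differentiable_def pd_eqI) (simp add: pd_def)
qed

lemma has_derivative_coord_fun:
  assumes "(p has_real_derivative p') (at (x $ i))"
  shows "((\<lambda>y. p (y $ i)) has_derivative (\<lambda>h. p' * h $ i)) (at x)"
proof -
  have "(p has_derivative (*) p') (at (x $ i))"
    using assms by (simp add: has_field_derivative_def)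
  then show ?thesis
    by (rule has_derivative_compose [rotated])
       (intro bounded_linear.has_derivative [OF bounded_linear_vec_nth] has_derivative_ident)
qed

lemma coord_fun:
  assumes "(p has_real_derivative p') (at (x $ i))"
  shows "(\<lambda>y. p (y $ i)) differentiable at x"
    and "pd j (\<lambda>y. p (y $ i)) x = (if j = i then p' else 0)"
  using has_derivative_coord_fun [OF assms] pd_eqI [OF has_derivative_coord_fun [OF assms]]
  by (auto simp: differentiable_def axis_def)

text \<open>Boundedness stands in for continuity up to the boundary. It makes all products with
  first partials integrable over a bounded open set, and it passes through the inverse of the
  diffeomorphism.\<close>

definition bdd_C1 :: "(real^'n::finite) set \<Rightarrow> (real^'n \<Rightarrow> real) \<Rightarrow> bool" where
  "bdd_C1 S f \<longleftrightarrow> (\<forall>x\<in>S. f differentiable at x) \<and> bounded (f ` S)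
     \<and> (\<forall>j. continuous_on S (pd j f) \<and> bounded (pd j f ` S))"

text \<open>A limit from inside, not a value on the frontier: the property then survives
  multiplication by a factor that is controlled on \<open>S\<close> only.\<close>

definition bdd_C1_0 :: "(real^'n::finite) set \<Rightarrow> (real^'n \<Rightarrow> real) \<Rightarrow> bool" where
  "bdd_C1_0 S f \<longleftrightarrow> bdd_C1 S f \<and> (\<forall>z\<in>frontier S. (f \<longlongrightarrow> 0) (at z within S))"

lemma bdd_C1D:
  assumes "bdd_C1 S f"
  shows "x \<in> S \<Longrightarrow> f differentiable at x" "bounded (f ` S)"
    "continuous_on S (pd j f)" "bounded (pd j f ` S)"
  using assms by (auto simp: bdd_C1_def)

lemma bdd_C1_continuous_on: "bdd_C1 S f \<Longrightarrow> continuous_on S f"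
  by (meson bdd_C1D(1) continuous_at_imp_continuous_on differentiable_imp_continuous_within)

lemma bdd_C1_0D: "bdd_C1_0 S f \<Longrightarrow> bdd_C1 S f"
  by (simp add: bdd_C1_0_def)

lemma bounded_mult_image:
  fixes f g :: "'a \<Rightarrow> real"
  assumes "bounded (f ` S)" "bounded (g ` S)"
  shows "bounded ((\<lambda>x. f x * g x) ` S)"
proof -
  from assms obtain a b where "\<And>x. x \<in> S \<Longrightarrow> \<bar>f x\<bar> \<le> a" "\<And>x. x \<in> S \<Longrightarrow> \<bar>g x\<bar> \<le> b"
    by (auto simp: bounded_iff)
  then have "\<And>x. x \<in> S \<Longrightarrow> \<bar>f x * g x\<bar> \<le> a * b"
    by (simp add: abs_mult mult_mono')
  then show ?thesis
    by (auto simp: bounded_iff)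
qed

text \<open>The partial derivatives may be given by formulas \<open>g j\<close> that agree with them
  on \<open>S\<close> alone, so regularity can be read off the formula.\<close>

lemma bdd_C1I:
  assumes "\<And>x. x \<in> S \<Longrightarrow> f differentiable at x" "bounded (f ` S)"
    and "\<And>j x. x \<in> S \<Longrightarrow> pd j f x = g j x" "\<And>j. continuous_on S (g j)" "\<And>j. bounded (g j ` S)"
  shows "bdd_C1 S f"
proof -
  have "pd j f ` S = g j ` S" for j
    using assms(3) by (auto simp: image_iff)
  moreover have "continuous_on S (pd j f)" for j
    using assms(3,4) by (simp cong: continuous_on_cong)
  ultimately show ?thesis
    using assms by (simp add: bdd_C1_def)
qed

section \<open>Closure under algebraic operations\<close>

lemma bdd_C1_const: "bdd_C1 S (\<lambda>x. c)"
  by (rule bdd_C1I [where g = "\<lambda>j x. 0"]) (auto simp: pd_const bounded_iff)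

lemma bdd_C1_coord: "bounded S \<Longrightarrow> bdd_C1 S (\<lambda>x. x $ i)"
proof (rule bdd_C1I [where g = "\<lambda>j x. if j = i then 1 else 0"])
  assume "bounded S"
  then show "bounded ((\<lambda>x. x $ i) ` S)"
    by (rule bounded_component_cart)
  show "(\<lambda>x. x $ i) differentiable at x" for x :: "real^'a"
    using coord_fun(1) [of "\<lambda>t. t" 1 x i] by simp
  show "pd j (\<lambda>x. x $ i) x = (if j = i then 1 else 0)" for j and x :: "real^'a"
    using coord_fun(2) [of "\<lambda>t. t" 1 x i] by simp
qed (auto simp: bounded_iff)

lemma bdd_C1_add:
  assumes "bdd_C1 S f" "bdd_C1 S g"
  shows "bdd_C1 S (\<lambda>x. f x + g x)"
  by (rule bdd_C1I [where g = "\<lambda>j x. pd j f x + pd j g x"])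
    (intro differentiable_add bounded_plus_comp continuous_on_add pd_add bdd_C1D [OF assms(1)]
       bdd_C1D [OF assms(2)]; assumption)+

lemma bdd_C1_mult:
  assumes "bdd_C1 S f" "bdd_C1 S g"
  shows "bdd_C1 S (\<lambda>x. f x * g x)"
  by (rule bdd_C1I [where g = "\<lambda>j x. f x * pd j g x + pd j f x * g x"])
    (intro differentiable_mult bounded_mult_image bounded_plus_comp continuous_on_add
       continuous_on_mult pd_mult bdd_C1D [OF assms(1)] bdd_C1D [OF assms(2)]
       bdd_C1_continuous_on [OF assms(1)] bdd_C1_continuous_on [OF assms(2)]; assumption)+

lemma bdd_C1_sum:
  assumes "\<And>i. i \<in> I \<Longrightarrow> bdd_C1 S (f i)"
  shows "bdd_C1 S (\<lambda>x. \<Sum>i\<in>I. f i x)"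
  using assms by (induction I rule: infinite_finite_induct) (auto intro: bdd_C1_const bdd_C1_add)

lemma bdd_C1_prod:
  assumes "\<And>i. i \<in> I \<Longrightarrow> bdd_C1 S (f i)"
  shows "bdd_C1 S (\<lambda>x. \<Prod>i\<in>I. f i x)"
  using assms by (induction I rule: infinite_finite_induct) (auto intro: bdd_C1_const bdd_C1_mult)

lemma bdd_C1_power: "bdd_C1 S f \<Longrightarrow> bdd_C1 S (\<lambda>x. f x ^ n)"
  by (induction n) (auto intro: bdd_C1_const bdd_C1_mult)

lemma bdd_C1_minus: "bdd_C1 S f \<Longrightarrow> bdd_C1 S (\<lambda>x. - f x)"
  using bdd_C1_mult [OF bdd_C1_const [of S "-1"]] by simp

lemma bdd_C1_diff: "bdd_C1 S f \<Longrightarrow> bdd_C1 S g \<Longrightarrow> bdd_C1 S (\<lambda>x. f x - g x)"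
  using bdd_C1_add [OF _ bdd_C1_minus] by fastforce

lemma bdd_C1_divide_const: "bdd_C1 S f \<Longrightarrow> bdd_C1 S (\<lambda>x. f x / c)"
  using bdd_C1_mult [OF _ bdd_C1_const [of S "inverse c"]] by (simp add: divide_inverse)

lemma bdd_C1_inverse:
  assumes "bdd_C1 S f" "c > 0" "\<And>x. x \<in> S \<Longrightarrow> c \<le> \<bar>f x\<bar>"
  shows "bdd_C1 S (\<lambda>x. inverse (f x))"
proof -
  have nz: "f x \<noteq> 0" if "x \<in> S" for x
    using assms(2,3) that by fastforce
  have bdd: "bounded ((\<lambda>x. inverse (f x)) ` S)"
    unfolding bounded_iff using assms(2,3) 
    by (intro exI [of _ "inverse c"]) (auto intro: le_imp_inverse_le)
  have cont: "continuous_on S (\<lambda>x. inverse (f x))"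
    using nz bdd_C1_continuous_on [OF assms(1)] by (intro continuous_on_inverse) auto
  show ?thesis
  proof (rule bdd_C1I)
    show "(\<lambda>x. inverse (f x)) differentiable at x" if "x \<in> S" for x
      using bdd_C1D(1) [OF assms(1) that] nz [OF that] by (rule differentiable_inverse)
    \<comment> \<open>The sign is written as a factor \<open>- 1\<close> so that the product rules
      alone yield continuity and boundedness.\<close>
    show "pd j (\<lambda>x. inverse (f x)) x = inverse (f x) * (- 1 * (pd j f x * inverse (f x)))"
      if "x \<in> S" for j x
      using pd_inverse [OF bdd_C1D(1) [OF assms(1) that] nz [OF that]] by simp
    show "continuous_on S (\<lambda>x. inverse (f x) * (- 1 * (pd j f x * inverse (f x))))" for j
      by (intro continuous_on_mult cont continuous_on_const bdd_C1D(3) [OF assms(1)])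
    show "bounded ((\<lambda>x. inverse (f x) * (- 1 * (pd j f x * inverse (f x)))) ` S)" for j
      by (intro bounded_mult_image bdd bdd_C1D(4) [OF assms(1)]) (auto simp: bounded_iff)
  qed (rule bdd)
qed

lemmas bdd_C1_intros = bdd_C1_const bdd_C1_coord bdd_C1_add bdd_C1_mult bdd_C1_sum bdd_C1_prod
  bdd_C1_power bdd_C1_minus bdd_C1_diff bdd_C1_divide_const

lemma bdd_C1_0_zero: "bdd_C1_0 S (\<lambda>x. 0)"
  by (simp add: bdd_C1_0_def bdd_C1_const)

lemma bdd_C1_0_add: "bdd_C1_0 S f \<Longrightarrow> bdd_C1_0 S g \<Longrightarrow> bdd_C1_0 S (\<lambda>x. f x + g x)"
  by (auto simp: bdd_C1_0_def intro: bdd_C1_add tendsto_add_zero)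

lemma bdd_C1_0_mult:
  assumes "bdd_C1_0 S f" "bdd_C1 S g"
  shows "bdd_C1_0 S (\<lambda>x. f x * g x)"
  unfolding bdd_C1_0_def
proof (intro conjI ballI)
  show "bdd_C1 S (\<lambda>x. f x * g x)"
    using assms bdd_C1_mult bdd_C1_0D by blast
  fix z assume "z \<in> frontier S"
  then have *: "(f \<longlongrightarrow> 0) (at z within S)"
    using assms(1) by (simp add: bdd_C1_0_def)
  obtain C where C: "\<And>x. x \<in> S \<Longrightarrow> norm (g x) \<le> C"
    using bdd_C1D(2) [OF assms(2)] by (auto simp: bounded_iff)
  have "((\<lambda>x. norm (f x) * C) \<longlongrightarrow> 0) (at z within S)"
    using tendsto_mult_left_zero [OF tendsto_norm_zero [OF *]] by simp
  then show "((\<lambda>x. f x * g x) \<longlongrightarrow> 0) (at z within S)"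
  proof (rule Lim_null_comparison [rotated])
    show "\<forall>\<^sub>F x in at z within S. norm (f x * g x) \<le> norm (f x) * C"
      unfolding eventually_at_filter using C
      by (auto simp: abs_mult intro!: mult_left_mono always_eventually)
  qed
qed

lemma bdd_C1_0_mult_left: "bdd_C1 S g \<Longrightarrow> bdd_C1_0 S f \<Longrightarrow> bdd_C1_0 S (\<lambda>x. g x * f x)"
  using bdd_C1_0_mult [of S f g] by (simp add: mult.commute)

lemma bdd_C1_0_sum:
  assumes "\<And>i. i \<in> I \<Longrightarrow> bdd_C1_0 S (f i)"
  shows "bdd_C1_0 S (\<lambda>x. \<Sum>i\<in>I. f i x)"
  using assms by (induction I rule: infinite_finite_induct) (auto intro: bdd_C1_0_zero bdd_C1_0_add)

lemma bdd_C1_0_diff: "bdd_C1_0 S f \<Longrightarrow> bdd_C1_0 S g \<Longrightarrow> bdd_C1_0 S (\<lambda>x. f x - g x)"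
  using bdd_C1_0_add [OF _ bdd_C1_0_mult_left [OF bdd_C1_const [of S "-1"]], of f g] by simp

section \<open>Integration by parts\<close>

lemma absolutely_integrable_bounded_continuous:
  fixes f :: "'a::euclidean_space \<Rightarrow> real"
  assumes "open S" "bounded S" "continuous_on S f" "bounded (f ` S)"
  shows "f absolutely_integrable_on S"
proof -
  obtain C where C: "\<And>x. x \<in> S \<Longrightarrow> norm (f x) \<le> C"
    using assms(4) by (auto simp: bounded_iff)
  have S: "S \<in> lmeasurable"
    using assms lmeasurable_open by blast
  show ?thesis
  proof (rule measurable_bounded_by_integrable_imp_absolutely_integrable)
    show "f \<in> borel_measurable (lebesgue_on S)"
      using assms(3) S by (intro continuous_imp_measurable_on_sets_lebesgue) auto
    show "(\<lambda>x. C) integrable_on S"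
      using S integrable_on_const by blast
  qed (use S C in auto)
qed

text \<open>If \<open>U\<close> does not contain the whole interval, \<open>h\<close> vanishes at the first and at the last point
  outside \<open>U\<close>, and the mean value theorem applies on both ends.\<close>
lemma increment_bound_zero_outside:
  fixes h :: "real \<Rightarrow> real"
  assumes cont: "continuous_on UNIV h" and "open U" and zero: "\<And>s. s \<notin> U \<Longrightarrow> h s = 0"
    and der: "\<And>s. s \<in> U \<Longrightarrow> (h has_real_derivative h' s) (at s)"
    and L: "\<And>s. s \<in> U \<Longrightarrow> \<bar>h' s\<bar> \<le> L" and L0: "0 \<le> L" and "a \<le> b"
  shows "\<bar>h b - h a\<bar> \<le> L * (b - a)"
proof -
  have mvt: "\<bar>h d - h c\<bar> \<le> L * (d - c)" if "c \<le> d" "{c<..<d} \<subseteq> U" for c d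
  proof (cases "c = d")
    case False
    have "\<exists>x\<in>{c<..<d}. norm (h d - h c) \<le> norm ((*) (h' x) (d - c))"
    proof (rule mvt_general)
      show "continuous_on {c..d} h"
        using cont continuous_on_subset by blast
      show "(h has_derivative (*) (h' x)) (at x)" if "c < x" "x < d" for x
        using der [of x] that \<open>{c<..<d} \<subseteq> U\<close> by (auto simp: has_field_derivative_def)
    qed (use that False in auto)
    then obtain x where x: "x \<in> {c<..<d}" and le: "\<bar>h d - h c\<bar> \<le> \<bar>h' x\<bar> * \<bar>d - c\<bar>"
      by (auto simp: abs_mult)
    have "\<bar>h' x\<bar> * \<bar>d - c\<bar> \<le> L * \<bar>d - c\<bar>"
      using L x that by (intro mult_right_mono) auto
    then show ?thesis
      using le that by linarith
  qed auto
  show ?thesis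
  proof (cases "{a..b} \<subseteq> U")
    case True
    then show ?thesis
      using mvt \<open>a \<le> b\<close> by (meson greaterThanLessThan_subseteq_atLeastAtMost_iff order_refl subset_trans)
  next
    case False
    define K where "K = {a..b} - U"
    have "compact K" "K \<noteq> {}"
      using False \<open>open U\<close> by (auto simp: K_def intro: compact_diff)
    then obtain c d where c: "c \<in> K" "\<And>s. s \<in> K \<Longrightarrow> c \<le> s" and d: "d \<in> K" "\<And>s. s \<in> K \<Longrightarrow> s \<le> d"
      by (meson compact_attains_inf compact_attains_sup)
    have hc: "h c = 0" and hd: "h d = 0" and le: "a \<le> c" "c \<le> d" "d \<le> b"
      using c d zero by (auto simp: K_def)
    have "s \<in> U" if "s \<in> {a<..<c}" for s
      using c(2) [of s] that le by (cases "s \<in> U") (auto simp: K_def)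
    moreover have "s \<in> U" if "s \<in> {d<..<b}" for s
      using d(2) [of s] that le by (cases "s \<in> U") (auto simp: K_def)
    ultimately have "{a<..<c} \<subseteq> U" "{d<..<b} \<subseteq> U"
      by blast+
    then have "\<bar>h c - h a\<bar> \<le> L * (c - a)" "\<bar>h b - h d\<bar> \<le> L * (b - d)"
      using mvt le by auto
    moreover have "L * (c - a) + L * (b - d) \<le> L * (b - a)"
      using le L0 by (simp flip: distrib_left add: mult_left_mono)
    ultimately show ?thesis
      using hc hd by linarith
  qed
qed

text \<open>Since \<open>g\<close> vanishes off the box, its integral can be taken over the whole
  space, where all translates share the same value. Differences of translates then integrate to 0
  with no boundary layer to track.\<close>

lemma has_integral_translation_UNIV:
  fixes g :: "'a::euclidean_space \<Rightarrow> real"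
  assumes "(g has_integral I) (cbox (-a) a)" and zero: "\<And>x. x \<notin> cbox (-a) a \<Longrightarrow> g x = 0"
  shows "((\<lambda>x. g (x + c)) has_integral I) UNIV"
proof -
  have "((\<lambda>x. g (x + c)) has_integral I) (cbox (- a - c) (a - c))"
    using has_integral_affinity' [OF assms(1), of 1 c] by simp
  moreover have "g (x + c) = 0" if "x \<notin> cbox (- a - c) (a - c)" for x
    using that by (intro zero) (auto simp: mem_box algebra_simps)
  ultimately show ?thesis
    by (rule has_integral_on_superset) auto
qed

lemma open_line_preimage:
  fixes S :: "'a::real_normed_vector set"
  assumes "open S"
  shows "open {t::real. x + t *\<^sub>R e \<in> S}"
proof -
  have "continuous_on UNIV (\<lambda>t::real. x + t *\<^sub>R e)"
    by (intro continuous_intros)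
  from open_vimage [OF assms this] show ?thesis
    by (simp add: vimage_def)
qed

text \<open>Off the frontier a point is interior to \<open>S\<close> or to its complement, so near
  it the extension is \<open>f\<close> or 0. Frontier points are excluded because the extension may
  have a kink there.\<close>

lemma has_derivative_zero_extension:
  assumes "open S" "bdd_C1_0 S f" "x \<notin> frontier S"
  shows "((\<lambda>t. if x + t *\<^sub>R axis j 1 \<in> S then f (x + t *\<^sub>R axis j 1) else 0) has_real_derivative
           (if x \<in> S then pd j f x else 0)) (at 0)"
proof (cases "x \<in> S")
  case True
  have line: "open {t::real. x + t *\<^sub>R axis j 1 \<in> S}"
    using \<open>open S\<close> by (rule open_line_preimage)
  have d1: "((\<lambda>t. x + t *\<^sub>R axis j 1) has_derivative (\<lambda>t. t *\<^sub>R axis j (1::real))) (at (0::real))"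
    by (auto intro!: derivative_eq_intros)
  have d2: "(f has_derivative frechet_derivative f (at x)) (at (x + 0 *\<^sub>R axis j 1))"
    using bdd_C1D(1) [OF bdd_C1_0D [OF assms(2)] True] has_frechet_derivative by simp
  interpret L: bounded_linear "frechet_derivative f (at x)"
    using d2 has_derivative_bounded_linear by blast
  have "((\<lambda>t. f (x + t *\<^sub>R axis j 1)) has_derivative (\<lambda>t. frechet_derivative f (at x) (t *\<^sub>R axis j 1))) (at 0)"
    using diff_chain_at [OF d1 d2] by (simp add: o_def)
  then have "((\<lambda>t. f (x + t *\<^sub>R axis j 1)) has_real_derivative pd j f x) (at 0)"
    by (simp add: has_field_derivative_def L.scaleR pd_def mult.commute [of "frechet_derivative f (at x) _"])
      (simp add: mult_commute_abs)
  then have "((\<lambda>t. if x + t *\<^sub>R axis j 1 \<in> S then f (x + t *\<^sub>R axis j 1) else 0) has_real_derivative pd j f x) (at 0)"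
    by (rule has_field_derivative_transform_within_open [OF _ line]) (use True in auto)
  then show ?thesis
    using True by simp
next
  case False
  then have "x \<in> - closure S"
    using assms(1,3) by (simp add: frontier_def interior_open)
  moreover have line: "open {t::real. x + t *\<^sub>R axis j 1 \<in> - closure S}"
    by (intro open_line_preimage) auto
  have "((\<lambda>t. 0) has_real_derivative 0) (at (0::real))"
    by simp
  then have "((\<lambda>t. if x + t *\<^sub>R axis j 1 \<in> S then f (x + t *\<^sub>R axis j 1) else 0) has_real_derivative 0) (at 0)"
  proof (rule has_field_derivative_transform_within_open [OF _ line])
    show "0 \<in> {t. x + t *\<^sub>R axis j 1 \<in> - closure S}"
      using \<open>x \<in> - closure S\<close> by simp
    show "0 = (if x + t *\<^sub>R axis j 1 \<in> S then f (x + t *\<^sub>R axis j 1) else 0)"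
      if "t \<in> {t. x + t *\<^sub>R axis j 1 \<in> - closure S}" for t
      using that closure_subset by auto
  qed
  then show ?thesis
    using False by simp
qed

text \<open>This is where the boundary condition enters: the limit 0 closes the gap at frontier
  points. Continuity is what allows the mean value argument to cross the boundary.\<close>

lemma continuous_zero_extension:
  assumes "open S" "bdd_C1_0 S f"
  shows "continuous_on UNIV (\<lambda>x. if x \<in> S then f x else 0)" (is "continuous_on UNIV ?g")
  unfolding continuous_on_eq_continuous_within
proof
  fix x
  consider "x \<in> S" | "x \<in> frontier S" | "x \<in> - closure S"
    using assms(1) by (auto simp: frontier_def interior_open)
  then show "isCont ?g x"
  proof cases
    case 1
    then have "isCont f x"
      using bdd_C1D(1) [OF bdd_C1_0D [OF assms(2)]] differentiable_imp_continuous_within by blast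
    then show ?thesis
      by (rule continuous_transform_within_openin [where S = S and T = UNIV]) (use 1 assms in auto)
  next
    case 2
    then have "(f \<longlongrightarrow> 0) (at x within S)"
      using assms(2) by (simp add: bdd_C1_0_def)
    then have "(?g \<longlongrightarrow> 0) (at x)"
      unfolding tendsto_iff eventually_at_filter by (auto elim: eventually_mono)
    moreover have "x \<notin> S"
      using 2 assms(1) by (simp add: frontier_def interior_open)
    ultimately show ?thesis
      by (simp add: isCont_def)
  next
    case 3
    show ?thesis
      by (rule continuous_transform_within_openin [where S = "- closure S" and T = UNIV and f = "\<lambda>x. 0"])
        (use 3 closure_subset in auto)
  qed
qed

lemma integral_pd_zero:
  fixes f :: "real^'n::finite \<Rightarrow> real"
  assumes S: "open S" "bounded S" "negligible (frontier S)" and f: "bdd_C1_0 S f"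
  shows "integral S (pd j f) = 0"
proof -
  define g where "g = (\<lambda>x. if x \<in> S then f x else 0)"
  define e :: "real^'n" where "e = axis j 1"
  note f' = bdd_C1_0D [OF f]
  obtain L where L: "\<And>x. x \<in> S \<Longrightarrow> \<bar>pd j f x\<bar> \<le> L" and "0 \<le> L"
    using bdd_C1D(4) [OF f', of j] unfolding bounded_iff
    by (metis abs_ge_zero imageI order_trans real_norm_def le_cases)
  have contg: "continuous_on UNIV g"
    unfolding g_def by (rule continuous_zero_extension [OF S(1) f])
  have der: "((\<lambda>t. g (x + t *\<^sub>R e)) has_real_derivative (if x \<in> S then pd j f x else 0)) (at 0)"
    if "x \<notin> frontier S" for x
    using has_derivative_zero_extension [OF S(1) f that] by (simp add: g_def e_def)
  have lip: "\<bar>g (x + t *\<^sub>R e) - g x\<bar> \<le> L * t" if "0 \<le> t" for x t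
  proof -
    have "\<bar>g (x + t *\<^sub>R e) - g (x + 0 *\<^sub>R e)\<bar> \<le> L * (t - 0)"
    proof (rule increment_bound_zero_outside [where h = "\<lambda>t. g (x + t *\<^sub>R e)"
          and U = "{t. x + t *\<^sub>R e \<in> S}" and h' = "\<lambda>t. pd j f (x + t *\<^sub>R e)"])
      show "continuous_on UNIV (\<lambda>t. g (x + t *\<^sub>R e))"
        by (rule continuous_on_compose2 [OF contg]) (auto intro!: continuous_intros)
      show "open {t. x + t *\<^sub>R e \<in> S}"
        using S(1) by (rule open_line_preimage)
      show "((\<lambda>t. g (x + t *\<^sub>R e)) has_real_derivative pd j f (x + s *\<^sub>R e)) (at s)"
        if "s \<in> {t. x + t *\<^sub>R e \<in> S}" for s
      proof -
        have "x + s *\<^sub>R e \<notin> frontier S"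
          using that S(1) by (simp add: frontier_def interior_open)
        from der [OF this] that
        have "((\<lambda>t. g (x + s *\<^sub>R e + t *\<^sub>R e)) has_real_derivative pd j f (x + s *\<^sub>R e)) (at (s - s))"
          by simp
        then have "((\<lambda>t. g (x + s *\<^sub>R e + (t - s) *\<^sub>R e)) has_real_derivative pd j f (x + s *\<^sub>R e)) (at s)"
          using DERIV_shift [of "\<lambda>t. g (x + s *\<^sub>R e + t *\<^sub>R e)" "pd j f (x + s *\<^sub>R e)" s "-s"] by simp
        then show ?thesis
          by (simp add: algebra_simps)
      qed
    qed (use L \<open>0 \<le> L\<close> that in \<open>auto simp: g_def\<close>)
    then show ?thesis
      by simp
  qed
  obtain a where a: "S \<subseteq> cbox (-a) a"
    using S(2) bounded_subset_cbox_symmetric by blast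
  define I where "I = integral (cbox (-a) a) g"
  have "(g has_integral I) (cbox (-a) a)"
    unfolding I_def by (intro integrable_integral integrable_continuous continuous_on_subset [OF contg]) auto
  then have shift: "((\<lambda>x. g (x + c)) has_integral I) UNIV" for c
    by (rule has_integral_translation_UNIV) (use a in \<open>auto simp: g_def\<close>)
  \<comment> \<open>All step lengths \<open>r k\<close> are at most 1, so one box around the unit
    enlargement of \<open>S\<close> supports every difference quotient and carries the constant
    dominating function.\<close>
  have "bounded (\<Union>x\<in>S. cball x 1)"
  proof -
    obtain R where "\<And>x. x \<in> S \<Longrightarrow> norm x \<le> R"
      using S(2) by (auto simp: bounded_iff)
    then have "\<And>y. y \<in> (\<Union>x\<in>S. cball x 1) \<Longrightarrow> norm y \<le> R + 1"
      by (auto simp: dist_norm norm_minus_commute) (smt (verit, best) norm_triangle_sub)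
    then show ?thesis
      unfolding bounded_iff by blast
  qed
  then obtain b where b: "(\<Union>x\<in>S. cball x 1) \<subseteq> cbox (-b) b"
    using bounded_subset_cbox_symmetric by blast
  define r where "r k = inverse (real (Suc k))" for k
  have r: "0 < r k" "r k \<le> 1" for k
    by (auto simp: r_def field_simps)
  define q where "q k x = (g (x + r k *\<^sub>R e) - g x) / r k" for k x
  have q_int: "(q k has_integral 0) UNIV" for k
  proof -
    have "((\<lambda>x. (g (x + r k *\<^sub>R e) - g (x + 0)) / r k) has_integral (I - I) / r k) UNIV"
      by (intro has_integral_divide has_integral_diff shift)
    moreover have "q k = (\<lambda>x. (g (x + r k *\<^sub>R e) - g (x + 0)) / r k)"
      by (simp add: q_def fun_eq_iff)
    ultimately show ?thesis
      by simp
  qed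
  \<comment> \<open>On the frontier the quotients need not converge to the required limit. Setting
    them to 0 on this negligible set keeps the integrals and gives convergence at every
    point.\<close>
  define q' where "q' k x = (if x \<in> frontier S then 0 else q k x)" for k x
  have q'_int: "(q' k has_integral 0) UNIV" for k
    by (rule has_integral_spike [OF S(3) _ q_int]) (auto simp: q'_def)
  have lim: "(\<lambda>k. integral UNIV (q' k)) \<longlonglongrightarrow> integral UNIV (\<lambda>x. if x \<in> S then pd j f x else 0)"
  proof (rule dominated_convergence(2))
    show "q' k integrable_on UNIV" for k
      using q'_int by blast
    show "(\<lambda>x. if x \<in> cbox (-b) b then L else 0) integrable_on UNIV"
      by (simp add: integrable_restrict_UNIV integrable_const)
    show "norm (q' k x) \<le> (if x \<in> cbox (-b) b then L else 0)" for k x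
    proof (cases "x \<in> cbox (-b) b")
      case True
      then show ?thesis
        using lip [of "r k" x] r [of k] \<open>0 \<le> L\<close> by (auto simp: q'_def q_def field_simps)
    next
      case False
      have "x \<notin> S"
      proof
        assume "x \<in> S"
        then have "x \<in> (\<Union>x\<in>S. cball x 1)"
          by (intro UN_I [of x]) auto
        then show False
          using False b by blast
      qed
      moreover have "x + r k *\<^sub>R e \<notin> S"
      proof
        assume "x + r k *\<^sub>R e \<in> S"
        moreover have "x \<in> cball (x + r k *\<^sub>R e) 1"
          using r [of k] by (simp add: dist_norm e_def)
        ultimately show False
          using False b by blast
      qed
      ultimately show ?thesis
        using False by (simp add: q'_def q_def g_def)
    qed
    show "(\<lambda>k. q' k x) \<longlonglongrightarrow> (if x \<in> S then pd j f x else 0)" for x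
    proof (cases "x \<in> frontier S")
      case True
      then show ?thesis
        using S(1) by (simp add: q'_def frontier_def interior_open)
    next
      case False
      have "((\<lambda>t. (g (x + t *\<^sub>R e) - g x) / t) \<longlongrightarrow> (if x \<in> S then pd j f x else 0)) (at 0)"
        using der [OF False] by (simp add: DERIV_def)
      moreover have "filterlim r (at 0) sequentially"
        unfolding filterlim_at using LIMSEQ_inverse_real_of_nat r
        by (auto simp: r_def [abs_def])
      ultimately have "(\<lambda>k. (g (x + r k *\<^sub>R e) - g x) / r k) \<longlonglongrightarrow> (if x \<in> S then pd j f x else 0)"
        by (rule filterlim_compose)
      then show ?thesis
        using False by (simp add: q'_def q_def)
    qed
  qed
  have "(\<lambda>k. integral UNIV (q' k)) \<longlonglongrightarrow> 0"
    using integral_unique [OF q'_int] by simp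
  then have "integral UNIV (\<lambda>x. if x \<in> S then pd j f x else 0) = 0"
    using lim LIMSEQ_unique by blast
  then show ?thesis
    by (simp add: integral_restrict_UNIV)
qed

lemma bdd_C1_integrable:
  fixes S :: "(real^'n::finite) set"
  assumes S: "open S" "bounded S" and f: "bdd_C1 S f" and g: "bdd_C1 S g"
  shows "(\<lambda>x. f x * g x) absolutely_integrable_on S"
    and "(\<lambda>x. f x * pd j g x) absolutely_integrable_on S"
    and "(\<lambda>x. pd j f x * g x) absolutely_integrable_on S"
  by (intro absolutely_integrable_bounded_continuous continuous_on_mult bounded_mult_image
    bdd_C1_continuous_on [OF f] bdd_C1_continuous_on [OF g] bdd_C1D(2-4) [OF f] bdd_C1D(2-4) [OF g] S)+

text \<open>One vanishing factor is enough: the product \<open>f * g\<close> still tends to 0 at the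
  frontier, so the integral of its partial derivative is 0.\<close>

lemma integration_by_parts_pd:
  fixes S :: "(real^'n::finite) set"
  assumes S: "open S" "bounded S" "negligible (frontier S)"
    and f: "bdd_C1_0 S f" and g: "bdd_C1 S g"
  shows "integral S (\<lambda>x. pd j f x * g x) = - integral S (\<lambda>x. f x * pd j g x)"
proof -
  note f' = bdd_C1_0D [OF f]
  have "integral S (\<lambda>x. f x * pd j g x + pd j f x * g x) = integral S (pd j (\<lambda>x. f x * g x))"
    using pd_mult [OF bdd_C1D(1) [OF f'] bdd_C1D(1) [OF g]] by (intro integral_cong) simp
  also have "\<dots> = 0"
    by (intro integral_pd_zero S bdd_C1_0_mult f g)
  finally show ?thesis
    using bdd_C1_integrable(2,3) [OF S(1,2) f' g, of j, THEN set_lebesgue_integral_eq_integral(1)]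
    by (simp add: integral_add)
qed

section \<open>Diffeomorphic images of the cube\<close>

lemma open_ref_open_cube: "open ref_open_cube"
  by (simp add: ref_open_cube_def open_box)

lemma bounded_ref_open_cube: "bounded ref_open_cube"
  by (simp add: ref_open_cube_def bounded_box)

lemma compact_ref_cube: "compact ref_cube"
  by (simp add: ref_cube_def)

lemma ref_open_cube_subset: "ref_open_cube \<subseteq> ref_cube"
  by (simp add: ref_open_cube_def ref_cube_def box_subset_cbox)

lemma frontier_ref_open_cube: "frontier (ref_open_cube :: (real^'n::finite) set) = ref_cube - ref_open_cube"
proof -
  have "(0::real^'n) \<in> box (vec (-1)) (vec 1)"
    by (simp add: mem_box_cart)
  then have "closure (box (vec (-1)) (vec 1 :: real^'n)) = cbox (vec (-1)) (vec 1)"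
    by (intro closure_box) blast
  then show ?thesis
    by (simp add: frontier_def interior_open open_box ref_open_cube_def ref_cube_def)
qed

lemma negligible_frontier_ref_open_cube: "negligible (frontier ref_open_cube)"
  by (simp add: ref_open_cube_def negligible_convex_frontier)

lemma frontier_ref_open_cubeD:
  fixes z :: "real^'n::finite"
  assumes "z \<in> frontier ref_open_cube"
  shows "\<exists>i. z $ i = 1 \<or> z $ i = -1"
proof -
  have "\<And>i. -1 \<le> z $ i \<and> z $ i \<le> 1" and "\<exists>i. \<not> (-1 < z $ i \<and> z $ i < 1)"
    using assms unfolding frontier_ref_open_cube
    by (auto simp: ref_cube_def ref_open_cube_def mem_box_cart simp del: vec_1)
  then show ?thesis
    by (metis linorder_not_le order_antisym)
qed

lemma jac_nth: "jac F \<xi> $ i $ j = pd j F \<xi> $ i"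
  by (simp add: jac_def pd_def matrix_def)

lemma has_derivative_jac:
  assumes "F differentiable at \<xi>"
  shows "(F has_derivative (*v) (jac F \<xi>)) (at \<xi>)"
proof -
  have D: "(F has_derivative frechet_derivative F (at \<xi>)) (at \<xi>)"
    using assms by (rule has_frechet_derivative)
  then have "linear (frechet_derivative F (at \<xi>))"
    using has_derivative_bounded_linear bounded_linear.linear by blast
  then have "frechet_derivative F (at \<xi>) = (*v) (jac F \<xi>)"
    by (simp add: jac_def fun_eq_iff matrix_works)
  then show ?thesis
    using D by simp
qed

lemma invertible_matrix_inv:
  assumes "invertible A"
  shows "A ** matrix_inv A = mat 1" "matrix_inv A ** A = mat 1"
  using someI_ex [OF assms [unfolded invertible_def]] by (simp_all add: matrix_inv_def)

lemma bdd_C1_det: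
  assumes "\<And>i j. bdd_C1 S (\<lambda>x. A x $ i $ j)"
  shows "bdd_C1 S (\<lambda>x. det (A x))"
  unfolding det_def by (intro bdd_C1_sum bdd_C1_mult bdd_C1_const bdd_C1_prod assms)

text \<open>The sort \<open>wellorder\<close> on the index type is the one under which the change of
  variables theorem is stated.\<close>

locale cube_diffeo =
  fixes F :: "real^'n::{finite,wellorder} \<Rightarrow> real^'n::_"
  assumes smooth: "smooth_diffeo_cube F"
begin

abbreviation "Q \<equiv> ref_open_cube :: (real^'n::_) set"
abbreviation "\<Omega> \<equiv> dom_of F"
abbreviation "G \<equiv> inv_into ref_cube F"

lemma inj: "inj_on F ref_cube" and det_nz: "\<xi> \<in> ref_cube \<Longrightarrow> det (jac F \<xi>) \<noteq> 0"
  using smooth by (auto simp: smooth_diffeo_cube_def)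

text \<open>A Piola field contains the Jacobian, so its first partials involve second derivatives of
  \<open>F\<close>. They are continuous on the closed cube, and compactness turns this into the
  bounds required by \<open>bdd_C1\<close>.\<close>

lemma C2:
  shows differentiable: "\<xi> \<in> ref_cube \<Longrightarrow> F differentiable at \<xi>"
    and differentiable_pd: "\<xi> \<in> ref_cube \<Longrightarrow> pd j F differentiable at \<xi>"
    and continuous_pd_pd: "continuous_on ref_cube (pd i (pd j F))"
proof -
  obtain S where S: "open S" "ref_cube \<subseteq> S" and C: "\<And>k. Ck_on k S F"
    using smooth by (auto simp: smooth_diffeo_cube_def)
  have C2: "F differentiable_on S" "pd j F differentiable_on S" "continuous_on S (pd i (pd j F))" for i j
    using C [of "Suc (Suc 0)"] by auto
  then show "\<xi> \<in> ref_cube \<Longrightarrow> F differentiable at \<xi>" "\<xi> \<in> ref_cube \<Longrightarrow> pd j F differentiable at \<xi>"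
    using S by (metis at_within_open differentiable_on_def subsetD)+
  show "continuous_on ref_cube (pd i (pd j F))"
    using C2(3) S(2) continuous_on_subset by blast
qed

lemma continuous: "continuous_on ref_cube F"
  using differentiable by (meson continuous_at_imp_continuous_on differentiable_imp_continuous_within)

lemma jac_differentiable: "\<xi> \<in> ref_cube \<Longrightarrow> (\<lambda>\<xi>. jac F \<xi> $ i $ j) differentiable at \<xi>"
  by (simp add: jac_nth pd_component differentiable_pd)

lemma bdd_C1_jac: "bdd_C1 Q (\<lambda>\<xi>. jac F \<xi> $ i $ j)"
proof (rule bdd_C1I [where g = "\<lambda>k \<xi>. pd k (pd j F) \<xi> $ i"])
  note sub = subsetD [OF ref_open_cube_subset]
  show "(\<lambda>\<xi>. jac F \<xi> $ i $ j) differentiable at x" if "x \<in> Q" for x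
    using jac_differentiable sub [OF that] by blast
  show "pd k (\<lambda>\<xi>. jac F \<xi> $ i $ j) x = pd k (pd j F) x $ i" if "x \<in> Q" for k x
    using sub [OF that] by (simp add: jac_nth pd_component differentiable_pd)
  have "continuous_on ref_cube (\<lambda>\<xi>. jac F \<xi> $ i $ j)"
    using jac_differentiable by (meson continuous_at_imp_continuous_on differentiable_imp_continuous_within)
  then show "bounded ((\<lambda>\<xi>. jac F \<xi> $ i $ j) ` Q)"
    using compact_continuous_image [OF _ compact_ref_cube] compact_imp_bounded bounded_subset
      image_mono [OF ref_open_cube_subset] by metis
  have *: "continuous_on ref_cube (\<lambda>\<xi>. pd k (pd j F) \<xi> $ i)" for k
    by (intro continuous_on_component continuous_pd_pd)
  then show "continuous_on Q (\<lambda>\<xi>. pd k (pd j F) \<xi> $ i)" for k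
    using continuous_on_subset ref_open_cube_subset by blast
  show "bounded ((\<lambda>\<xi>. pd k (pd j F) \<xi> $ i) ` Q)" for k
    using compact_continuous_image [OF * compact_ref_cube] compact_imp_bounded bounded_subset
      image_mono [OF ref_open_cube_subset] by metis
qed

lemma continuous_det: "continuous_on ref_cube (\<lambda>\<xi>. det (jac F \<xi>))"
proof -
  have "continuous_on ref_cube (\<lambda>\<xi>. jac F \<xi> $ i $ j)" for i j
    using jac_differentiable by (meson continuous_at_imp_continuous_on differentiable_imp_continuous_within)
  then show ?thesis
    unfolding det_def
    by (intro continuous_on_sum continuous_on_mult continuous_on_const continuous_on_prod)
qed

text \<open>The modulus of the determinant attains a nonzero minimum on the compact cube, which is
  the lower bound that the rule for inverses asks for.\<close>

lemma bdd_C1_inverse_det: "bdd_C1 Q (\<lambda>\<xi>. inverse (det (jac F \<xi>)))"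
proof -
  have "continuous_on ref_cube (\<lambda>\<xi>. \<bar>det (jac F \<xi>)\<bar>)"
    using continuous_det by (intro continuous_intros)
  moreover have "ref_cube \<noteq> ({}::(real^'n::_) set)"
    by (auto simp: ref_cube_def interval_eq_empty_cart)
  ultimately obtain z :: "real^'n::_" where z: "z \<in> ref_cube"
    and "\<And>\<xi>. \<xi> \<in> ref_cube \<Longrightarrow> \<bar>det (jac F z)\<bar> \<le> \<bar>det (jac F \<xi>)\<bar>"
    using continuous_attains_inf [OF compact_ref_cube] by metis
  then show ?thesis
    using det_nz [OF z] ref_open_cube_subset
    by (intro bdd_C1_inverse [where c = "\<bar>det (jac F z)\<bar>"] bdd_C1_det bdd_C1_jac) auto
qed

text \<open>The determinant has no zero on the connected cube, so its sign is constant. The change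
  of variables produces the modulus while the Piola transform divides by the signed determinant;
  \<open>s\<close> is their quotient.\<close>

lemma det_sign: obtains s where "\<And>\<xi>. \<xi> \<in> Q \<Longrightarrow> \<bar>det (jac F \<xi>)\<bar> = s * det (jac F \<xi>)"
proof -
  have "connected ((\<lambda>\<xi>. det (jac F \<xi>)) ` ref_cube)"
    by (intro connected_continuous_image continuous_det convex_connected) (simp add: ref_cube_def)
  then have "(\<forall>\<xi>\<in>ref_cube. det (jac F \<xi>) \<le> 0) \<or> (\<forall>\<xi>\<in>ref_cube. 0 \<le> det (jac F \<xi>))"
    using det_nz unfolding connected_iff_interval by (smt (verit) imageE imageI)
  then show ?thesis
  proof
    assume "\<forall>\<xi>\<in>ref_cube. det (jac F \<xi>) \<le> 0"
    then show ?thesis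
      using ref_open_cube_subset by (intro that [of "-1"]) force
  next
    assume "\<forall>\<xi>\<in>ref_cube. 0 \<le> det (jac F \<xi>)"
    then show ?thesis
      using ref_open_cube_subset by (intro that [of 1]) force
  qed
qed

section \<open>The inverse map and the image domain\<close>

lemma G_in: "x \<in> \<Omega> \<Longrightarrow> G x \<in> Q" and F_G: "x \<in> \<Omega> \<Longrightarrow> F (G x) = x"
  and F_in: "\<xi> \<in> Q \<Longrightarrow> F \<xi> \<in> \<Omega>" and G_F: "\<xi> \<in> ref_cube \<Longrightarrow> G (F \<xi>) = \<xi>"
  using inj ref_open_cube_subset by (auto simp: dom_of_def inv_into_f_f subset_iff)

lemma continuous_G: "continuous_on (F ` ref_cube) G"
  by (rule continuous_on_inv [OF continuous compact_ref_cube]) (simp add: G_F)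

lemma open_dom: "open \<Omega>"
  unfolding dom_of_def
  using continuous inj ref_open_cube_subset open_ref_open_cube
  by (intro invariance_of_domain) (auto intro: continuous_on_subset inj_on_subset)

lemma dom_subset: "\<Omega> \<subseteq> F ` ref_cube"
  unfolding dom_of_def using ref_open_cube_subset by blast

lemma bounded_dom: "bounded \<Omega>"
  using compact_continuous_image [OF continuous compact_ref_cube] compact_imp_bounded bounded_subset
    dom_subset by blast

text \<open>The image of the closed cube is compact and so contains the closure of the domain;
  removing the image of the open cube leaves only images of boundary points.\<close>

lemma frontier_dom: "frontier \<Omega> \<subseteq> F ` frontier ref_open_cube"
proof -
  have "closure \<Omega> \<subseteq> F ` ref_cube"
    using compact_continuous_image [OF continuous compact_ref_cube] compact_imp_closed
      closure_minimal dom_subset by blast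
  moreover have "frontier \<Omega> = closure \<Omega> - \<Omega>"
    using open_dom by (simp add: frontier_def interior_open)
  ultimately show ?thesis
    unfolding frontier_ref_open_cube by (auto simp: dom_of_def)
qed

lemma negligible_frontier_dom: "negligible (frontier \<Omega>)"
proof (rule negligible_subset [OF _ frontier_dom])
  show "negligible (F ` frontier ref_open_cube)"
  proof (rule negligible_differentiable_image_negligible)
    show "F differentiable_on frontier ref_open_cube"
      using differentiable frontier_ref_open_cube
      by (auto simp: differentiable_on_def intro: differentiable_at_withinI)
  qed (auto simp: negligible_frontier_ref_open_cube)
qed

text \<open>Continuity of \<open>G\<close> is already known from compactness, so invertibility of
  the Jacobian is all that remains for the derivative of the inverse.\<close>

lemma has_derivative_G:
  assumes "x \<in> \<Omega>"
  shows "(G has_derivative (*v) (matrix_inv (jac F (G x)))) (at x)"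
proof (rule has_derivative_inverse_basic [where f = F and T = \<Omega>])
  have \<xi>: "G x \<in> ref_cube"
    using G_in [OF assms] ref_open_cube_subset by blast
  show "(F has_derivative (*v) (jac F (G x))) (at (G x))"
    by (intro has_derivative_jac differentiable \<xi>)
  show "bounded_linear ((*v) (matrix_inv (jac F (G x))))"
    by (rule matrix_vector_mul_bounded_linear)
  have "invertible (jac F (G x))"
    using det_nz [OF \<xi>] invertible_det_nz by blast
  then show "(*v) (matrix_inv (jac F (G x))) \<circ> (*v) (jac F (G x)) = id"
    by (simp add: fun_eq_iff matrix_vector_mul_assoc invertible_matrix_inv)
  show "continuous (at x) G"
    using continuous_on_subset [OF continuous_G dom_subset] assms
    by (simp add: continuous_on_eq_continuous_at open_dom)
qed (use open_dom assms F_G in auto)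

text \<open>Entries of the inverse Jacobian by Cramer's rule, which makes their regularity visible.\<close>
definition jac_inv :: "'n \<Rightarrow> 'n \<Rightarrow> real^'n::_ \<Rightarrow> real" where
  "jac_inv k j \<xi> =
    inverse (det (jac F \<xi>)) * det (\<chi> i l. if l = k then axis j 1 $ i else jac F \<xi> $ i $ l)"

lemma bdd_C1_jac_inv: "bdd_C1 Q (jac_inv k j)"
proof -
  have "bdd_C1 Q (\<lambda>\<xi>. (\<chi> i l. if l = k then axis j 1 $ i else jac F \<xi> $ i $ l) $ i' $ l')" for i' l'
    by (cases "l' = k") (simp_all add: bdd_C1_const bdd_C1_jac)
  then show ?thesis
    unfolding jac_inv_def [abs_def] by (intro bdd_C1_mult bdd_C1_inverse_det bdd_C1_det)
qed

lemma matrix_inv_axis: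
  assumes "\<xi> \<in> ref_cube"
  shows "(matrix_inv (jac F \<xi>) *v axis j 1) $ k = jac_inv k j \<xi>"
proof -
  have "invertible (jac F \<xi>)"
    using det_nz [OF assms] invertible_det_nz by blast
  then have "jac F \<xi> *v (matrix_inv (jac F \<xi>) *v axis j 1) = axis j 1"
    by (simp add: matrix_vector_mul_assoc invertible_matrix_inv)
  then show ?thesis
    unfolding cramer [OF det_nz [OF assms]] by (simp add: vec_eq_iff divide_inverse jac_inv_def mult.commute)
qed

lemma bdd_C1_comp_G:
  assumes f: "bdd_C1 Q f"
  shows "bdd_C1 \<Omega> (\<lambda>x. f (G x))"
proof -
  \<comment> \<open>The chain rule expression is kept as a function on the cube: its continuity and
    bounds are proved there and then carried over through \<open>G\<close>.\<close>
  define D where "D j \<xi> = (\<Sum>k\<in>UNIV. jac_inv k j \<xi> * pd k f \<xi>)" for j \<xi>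
  have contG: "continuous_on \<Omega> G"
    using continuous_on_subset [OF continuous_G dom_subset] .
  have der: "((\<lambda>x. f (G x)) has_derivative
      (\<lambda>h. \<Sum>k\<in>UNIV. (matrix_inv (jac F (G x)) *v h) $ k *\<^sub>R pd k f (G x))) (at x)"
    if "x \<in> \<Omega>" for x
    using diff_chain_at [OF has_derivative_G [OF that] has_derivative_pd [OF bdd_C1D(1) [OF f G_in [OF that]]]]
    by (simp add: o_def)
  have contD: "continuous_on Q (D j)" and bddD: "bounded (D j ` Q)" for j
  proof -
    show "continuous_on Q (D j)"
      unfolding D_def [abs_def]
      by (intro continuous_on_sum continuous_on_mult bdd_C1D(3) [OF f]
        bdd_C1_continuous_on [OF bdd_C1_jac_inv])
    have "bounded ((\<lambda>\<xi>. \<Sum>k\<in>K. jac_inv k j \<xi> * pd k f \<xi>) ` Q)" for K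
    proof (induction K rule: infinite_finite_induct)
      case (insert k K)
      then show ?case
        by (simp, intro bounded_plus_comp bounded_mult_image [OF bdd_C1D(2) [OF bdd_C1_jac_inv]] bdd_C1D(4) [OF f])
    qed (auto simp: bounded_iff)
    then show "bounded (D j ` Q)"
      unfolding D_def [abs_def] by blast
  qed
  have Gimg: "G ` \<Omega> \<subseteq> Q"
    using G_in by blast
  show ?thesis
  proof (rule bdd_C1I [where g = "\<lambda>j x. D j (G x)"])
    show "(\<lambda>x. f (G x)) differentiable at x" if "x \<in> \<Omega>" for x
      using der [OF that] differentiable_def by blast
    show "pd j (\<lambda>x. f (G x)) x = D j (G x)" if "x \<in> \<Omega>" for j x
      using pd_eqI [OF der [OF that]] matrix_inv_axis [OF subsetD [OF ref_open_cube_subset G_in [OF that]]]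
      by (simp add: D_def)
    show "continuous_on \<Omega> (\<lambda>x. D j (G x))" for j
      using continuous_on_compose2 [OF contD contG Gimg] .
    show "bounded ((\<lambda>x. f (G x)) ` \<Omega>)"
      using bdd_C1D(2) [OF f] Gimg by (metis bounded_subset image_image image_mono)
    show "bounded ((\<lambda>x. D j (G x)) ` \<Omega>)" for j
      using bddD [of j] Gimg by (metis bounded_subset image_image image_mono)
  qed
qed

lemma bdd_C1_0_comp_G:
  assumes f: "bdd_C1_0 Q f"
  shows "bdd_C1_0 \<Omega> (\<lambda>x. f (G x))"
  unfolding bdd_C1_0_def
proof (intro conjI ballI bdd_C1_comp_G bdd_C1_0D [OF f])
  fix z assume "z \<in> frontier \<Omega>"
  then obtain \<zeta> where \<zeta>: "\<zeta> \<in> frontier Q" "z = F \<zeta>"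
    using frontier_dom by blast
  then have "\<zeta> \<in> ref_cube" and "\<zeta> \<notin> Q"
    by (auto simp: frontier_ref_open_cube)
  have lim: "(f \<longlongrightarrow> 0) (at \<zeta> within Q)"
    using f \<zeta> by (simp add: bdd_C1_0_def)
  have "(G \<longlongrightarrow> G z) (at z within \<Omega>)"
    using continuous_G \<open>\<zeta> \<in> ref_cube\<close> \<zeta>(2) dom_subset tendsto_within_subset
    unfolding continuous_on_def by blast
  moreover have "G z = \<zeta>"
    using G_F \<open>\<zeta> \<in> ref_cube\<close> \<zeta>(2) by simp
  \<comment> \<open>The limit of \<open>f\<close> is punctured at \<open>\<zeta>\<close>. Avoiding
    \<open>\<zeta>\<close> is automatic, because \<open>G x\<close> lies in the open cube and
    \<open>\<zeta>\<close> on its boundary.\<close>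
  moreover have "eventually (\<lambda>x. G x \<in> Q \<and> G x \<noteq> \<zeta>) (at z within \<Omega>)"
    unfolding eventually_at_filter using G_in \<open>\<zeta> \<notin> Q\<close> by (intro always_eventually) auto
  ultimately have "filterlim G (at \<zeta> within Q) (at z within \<Omega>)"
    by (simp add: filterlim_at)
  then show "((\<lambda>x. f (G x)) \<longlongrightarrow> 0) (at z within \<Omega>)"
    using filterlim_compose [OF lim] by blast
qed

text \<open>The Piola transform before composition with the inverse map. All its factors live on the
  cube and are written as products, so regularity follows from the closure rules.\<close>

definition piola_hat :: "(real^'n::_ \<Rightarrow> real^'n::_) \<Rightarrow> real^'n::_ \<Rightarrow> real^'n::_" where
  "piola_hat \<Phi> \<xi> = (\<chi> i. inverse (det (jac F \<xi>)) * (\<Sum>l\<in>UNIV. jac F \<xi> $ i $ l * \<Phi> \<xi> $ l))"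

lemma piola_eq: "piola F \<Phi> x = piola_hat \<Phi> (G x)"
  by (simp add: piola_def piola_hat_def Let_def vec_eq_iff matrix_vector_mult_def divide_inverse)

lemma bdd_C1_piola_hat:
  assumes "\<And>l. bdd_C1 Q (\<lambda>\<xi>. \<Phi> \<xi> $ l)"
  shows "bdd_C1 Q (\<lambda>\<xi>. piola_hat \<Phi> \<xi> $ i)"
  unfolding piola_hat_def vec_lambda_beta
  by (intro bdd_C1_mult bdd_C1_sum bdd_C1_inverse_det bdd_C1_jac assms)

lemma bdd_C1_piola:
  assumes "\<And>l. bdd_C1 Q (\<lambda>\<xi>. \<Phi> \<xi> $ l)"
  shows "bdd_C1 \<Omega> (\<lambda>x. piola F \<Phi> x $ i)"
  unfolding piola_eq by (intro bdd_C1_comp_G bdd_C1_piola_hat assms)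

lemma bdd_C1_0_piola:
  assumes "\<And>l. bdd_C1_0 Q (\<lambda>\<xi>. \<Phi> \<xi> $ l)"
  shows "bdd_C1_0 \<Omega> (\<lambda>x. piola F \<Phi> x $ i)"
  unfolding piola_eq
proof (rule bdd_C1_0_comp_G)
  show "bdd_C1_0 Q (\<lambda>\<xi>. piola_hat \<Phi> \<xi> $ i)"
    unfolding piola_hat_def vec_lambda_beta
    by (intro bdd_C1_0_mult_left bdd_C1_0_sum bdd_C1_inverse_det bdd_C1_jac assms)
qed

section \<open>Change of variables and the convective term\<close>

lemma integral_dom:
  fixes r :: "real^'n::_ \<Rightarrow> real"
  assumes "r absolutely_integrable_on \<Omega>"
  shows "integral \<Omega> r = integral Q (\<lambda>\<xi>. \<bar>det (jac F \<xi>)\<bar> * r (F \<xi>))"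
proof -
  \<comment> \<open>The change of variables theorem is for vector-valued integrands, hence the
    detour through one-component vectors.\<close>
  define v where "v = (\<lambda>x. vec (r x) :: real^1)"
  have lin: "bounded_linear (vec :: real \<Rightarrow> real^1)"
    by (simp add: linear_conv_bounded_linear [symmetric] linear_vec)
  have v: "v absolutely_integrable_on F ` Q"
    using absolutely_integrable_linear [OF assms lin] by (simp add: v_def o_def dom_of_def)
  have Q: "Q \<in> sets lebesgue"
    by (intro fmeasurableD lmeasurable_open bounded_ref_open_cube open_ref_open_cube)
  have der: "(F has_derivative (*v) (jac F \<xi>)) (at \<xi> within Q)" if "\<xi> \<in> Q" for \<xi>
    using that ref_open_cube_subset
    by (intro has_derivative_at_withinI [OF has_derivative_jac [OF differentiable]]) blast
  have injQ: "inj_on F Q"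
    using inj ref_open_cube_subset inj_on_subset by blast
  have v': "(\<lambda>\<xi>. \<bar>det (matrix ((*v) (jac F \<xi>)))\<bar> *\<^sub>R v (F \<xi>)) absolutely_integrable_on Q"
    and eq: "integral Q (\<lambda>\<xi>. \<bar>det (matrix ((*v) (jac F \<xi>)))\<bar> *\<^sub>R v (F \<xi>)) = integral (F ` Q) v"
    using has_absolute_integral_change_of_variables [OF Q der injQ, of v "integral (F ` Q) v"] v by blast+
  have "integral \<Omega> r = integral (F ` Q) v $ 1"
    using integral_component_eq_cart [of v "F ` Q" 1] set_lebesgue_integral_eq_integral(1) [OF v]
    by (simp add: v_def dom_of_def)
  also have "\<dots> = integral Q (\<lambda>\<xi>. \<bar>det (jac F \<xi>)\<bar> * r (F \<xi>))"
    unfolding eq [symmetric] using integral_component_eq_cart [OF set_lebesgue_integral_eq_integral(1) [OF v'], of 1]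
    by (simp add: v_def)
  finally show ?thesis .
qed

text \<open>Pulling back to the cube replaces the Piola identity: the factor \<open>1 / det\<close> of the transform
  cancels the Jacobian of the substitution up to a constant sign, so only the divergence of the
  reference field enters.\<close>
lemma integral_transport_zero:
  assumes \<Phi>: "\<And>l. bdd_C1_0 Q (\<lambda>\<xi>. \<Phi> \<xi> $ l)"
    and div: "\<And>\<xi>. \<xi> \<in> Q \<Longrightarrow> (\<Sum>l\<in>UNIV. pd l (\<lambda>\<zeta>. \<Phi> \<zeta> $ l) \<xi>) = 0"
    and q: "bdd_C1 Q q"
  shows "integral \<Omega> (\<lambda>x. \<Sum>j\<in>UNIV. piola F \<Phi> x $ j * pd j (\<lambda>y. q (G y)) x) = 0"
proof -
  obtain s where s: "\<And>\<xi>. \<xi> \<in> Q \<Longrightarrow> \<bar>det (jac F \<xi>)\<bar> = s * det (jac F \<xi>)"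
    using det_sign by blast
  note \<Phi>' = bdd_C1_0D [OF \<Phi>]
  define p where "p = (\<lambda>y. q (G y))"
  have p: "bdd_C1 \<Omega> p"
    unfolding p_def using q by (rule bdd_C1_comp_G)
  \<comment> \<open>On the cube \<open>q\<close> equals \<open>p\<close> composed with
    \<open>F\<close>. Differentiating this form yields the transposed Jacobian directly and avoids
    its inverse.\<close>
  have chain: "pd l q \<xi> = (\<Sum>j\<in>UNIV. jac F \<xi> $ j $ l * pd j p (F \<xi>))" if "\<xi> \<in> Q" for l \<xi>
  proof -
    have "\<xi> \<in> ref_cube"
      using that ref_open_cube_subset by blast
    then have "((\<lambda>\<xi>. p (F \<xi>)) has_derivative
        (\<lambda>h. \<Sum>j\<in>UNIV. (jac F \<xi> *v h) $ j *\<^sub>R pd j p (F \<xi>))) (at \<xi>)"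
      using diff_chain_at [OF has_derivative_jac [OF differentiable] has_derivative_pd [OF bdd_C1D(1) [OF p F_in [OF that]]]]
      by (simp add: o_def)
    then have "(q has_derivative (\<lambda>h. \<Sum>j\<in>UNIV. (jac F \<xi> *v h) $ j *\<^sub>R pd j p (F \<xi>))) (at \<xi>)"
      by (rule has_derivative_transform_within_open [OF _ open_ref_open_cube that])
        (use G_F ref_open_cube_subset in \<open>auto simp: p_def\<close>)
    then show ?thesis
      using pd_eqI by (fastforce simp: matrix_vector_mult_basis column_def)
  qed
  \<comment> \<open>The Jacobian in the Piola field acts on the physical gradient of
    \<open>p\<close> and turns it into the reference gradient of \<open>q\<close>.\<close>
  have pull: "\<bar>det (jac F \<xi>)\<bar> * (\<Sum>j\<in>UNIV. piola F \<Phi> (F \<xi>) $ j * pd j p (F \<xi>))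
      = s * (\<Sum>l\<in>UNIV. \<Phi> \<xi> $ l * pd l q \<xi>)" if "\<xi> \<in> Q" for \<xi>
  proof -
    have \<xi>: "\<xi> \<in> ref_cube"
      using that ref_open_cube_subset by blast
    have "(\<Sum>j\<in>UNIV. piola F \<Phi> (F \<xi>) $ j * pd j p (F \<xi>))
      = inverse (det (jac F \<xi>)) * (\<Sum>j\<in>UNIV. \<Sum>l\<in>UNIV. \<Phi> \<xi> $ l * (jac F \<xi> $ j $ l * pd j p (F \<xi>)))"
      by (simp add: piola_eq piola_hat_def G_F \<xi> sum_distrib_left sum_distrib_right mult_ac)
    also have "\<dots> = inverse (det (jac F \<xi>)) * (\<Sum>l\<in>UNIV. \<Phi> \<xi> $ l * pd l q \<xi>)"
      by (subst sum.swap) (simp add: chain [OF that] sum_distrib_left)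
    finally show ?thesis
      using det_nz [OF \<xi>] s [OF that] by simp
  qed
  have "(\<lambda>x. \<Sum>j\<in>UNIV. piola F \<Phi> x $ j * pd j p x) absolutely_integrable_on \<Omega>"
    by (intro absolutely_integrable_sum bdd_C1_integrable open_dom bounded_dom bdd_C1_piola \<Phi>' p) auto
  then have "integral \<Omega> (\<lambda>x. \<Sum>j\<in>UNIV. piola F \<Phi> x $ j * pd j p x)
      = integral Q (\<lambda>\<xi>. s * (\<Sum>l\<in>UNIV. \<Phi> \<xi> $ l * pd l q \<xi>))"
    using integral_dom pull by (simp cong: integral_cong)
  also have "\<dots> = s * (\<Sum>l\<in>UNIV. integral Q (\<lambda>\<xi>. \<Phi> \<xi> $ l * pd l q \<xi>))"
    using bdd_C1_integrable(2) [OF open_ref_open_cube bounded_ref_open_cube \<Phi>' q, THEN set_lebesgue_integral_eq_integral(1)]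
    by (simp add: integral_sum)
  also have "\<dots> = s * - (\<Sum>l\<in>UNIV. integral Q (\<lambda>\<xi>. pd l (\<lambda>\<zeta>. \<Phi> \<zeta> $ l) \<xi> * q \<xi>))"
    using integration_by_parts_pd [OF open_ref_open_cube bounded_ref_open_cube negligible_frontier_ref_open_cube \<Phi> q]
    by (simp add: sum_negf)
  also have "\<dots> = s * - integral Q (\<lambda>\<xi>. \<Sum>l\<in>UNIV. pd l (\<lambda>\<zeta>. \<Phi> \<zeta> $ l) \<xi> * q \<xi>)"
    using bdd_C1_integrable(3) [OF open_ref_open_cube bounded_ref_open_cube \<Phi>' q, THEN set_lebesgue_integral_eq_integral(1)]
    by (simp add: integral_sum)
  also have "integral Q (\<lambda>\<xi>. \<Sum>l\<in>UNIV. pd l (\<lambda>\<zeta>. \<Phi> \<zeta> $ l) \<xi> * q \<xi>) = integral Q (\<lambda>\<xi>. 0)"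
    by (intro integral_cong) (simp add: div flip: sum_distrib_right)
  finally show ?thesis
    by (simp add: p_def)
qed

text \<open>Zero divergence and zero boundary values are asked of the transporting field only, so
  the transported one may be any regular Piola field.\<close>

lemma convection_orthogonal:
  assumes \<Phi>: "\<And>l. bdd_C1_0 Q (\<lambda>\<xi>. \<Phi> \<xi> $ l)"
    and div: "\<And>\<xi>. \<xi> \<in> Q \<Longrightarrow> (\<Sum>l\<in>UNIV. pd l (\<lambda>\<zeta>. \<Phi> \<zeta> $ l) \<xi>) = 0"
    and \<Psi>: "\<And>l. bdd_C1 Q (\<lambda>\<xi>. \<Psi> \<xi> $ l)"
  shows "L2ip \<Omega> (conv (piola F \<Phi>) (piola F \<Psi>)) (piola F \<Psi>) = 0"
proof -
  define u where "u = piola F \<Psi>"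
  \<comment> \<open>Half the squared speed as a function on the cube, the form in which the
    transport lemma takes it.\<close>
  define q where "q \<xi> = (\<Sum>i\<in>UNIV. piola_hat \<Psi> \<xi> $ i * piola_hat \<Psi> \<xi> $ i) / 2" for \<xi>
  have q: "bdd_C1 Q q"
    unfolding q_def by (intro bdd_C1_divide_const bdd_C1_sum bdd_C1_mult bdd_C1_piola_hat \<Psi>)
  have u: "bdd_C1 \<Omega> (\<lambda>x. u x $ i)" for i
    unfolding u_def by (intro bdd_C1_piola \<Psi>)
  have qG: "q (G x) = (1/2) * (\<Sum>i\<in>UNIV. u x $ i * u x $ i)" for x
    by (simp add: q_def u_def piola_eq)
  have pdq: "pd j (\<lambda>y. q (G y)) x = (\<Sum>i\<in>UNIV. u x $ i * pd j (\<lambda>y. u y $ i) x)" if "x \<in> \<Omega>" for j x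
  proof -
    note d = bdd_C1D(1) [OF u that]
    have "pd j (\<lambda>y. q (G y)) x = (1/2) * pd j (\<lambda>x. \<Sum>i\<in>UNIV. u x $ i * u x $ i) x"
      unfolding qG by (subst pd_mult) (auto simp: pd_const intro!: differentiable_sum differentiable_mult d)
    also have "pd j (\<lambda>x. \<Sum>i\<in>UNIV. u x $ i * u x $ i) x
        = (\<Sum>i\<in>UNIV. 2 * (u x $ i * pd j (\<lambda>y. u y $ i) x))"
      by (subst pd_sum) (auto simp: pd_mult d intro!: differentiable_mult d)
    finally show ?thesis
      by (simp flip: sum_distrib_left)
  qed
  have "L2ip \<Omega> (conv (piola F \<Phi>) u) u
      = integral \<Omega> (\<lambda>x. \<Sum>j\<in>UNIV. piola F \<Phi> x $ j * pd j (\<lambda>y. q (G y)) x)"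
    unfolding L2ip_def
  proof (rule integral_cong)
    fix x assume "x \<in> \<Omega>"
    have "conv (piola F \<Phi>) u x \<bullet> u x
        = (\<Sum>i\<in>UNIV. \<Sum>j\<in>UNIV. piola F \<Phi> x $ j * (u x $ i * pd j (\<lambda>y. u y $ i) x))"
      by (simp add: conv_def inner_vec_def sum_distrib_left sum_distrib_right mult_ac)
    also have "\<dots> = (\<Sum>j\<in>UNIV. piola F \<Phi> x $ j * pd j (\<lambda>y. q (G y)) x)"
      by (subst sum.swap) (simp add: pdq [OF \<open>x \<in> \<Omega>\<close>] sum_distrib_left)
    finally show "conv (piola F \<Phi>) u x \<bullet> u x = (\<Sum>j\<in>UNIV. piola F \<Phi> x $ j * pd j (\<lambda>y. q (G y)) x)" .
  qed
  also have "\<dots> = 0"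
    using \<Phi> div q by (rule integral_transport_zero)
  finally show ?thesis
    by (simp add: u_def)
qed

end

section \<open>Generalized Jacobi polynomials\<close>

text \<open>The ratio of neighbouring binomial coefficients without division. It also holds for
  \<open>k \<ge> n\<close>, where both sides are 0.\<close>

lemma binomial_step:
  "real (Suc k) * real (n choose Suc k) = real (n - k) * real (n choose k)"
  unfolding of_nat_mult [symmetric] by (metis binomial_absorb_comp binomial_absorption)

text \<open>The classical formula for the derivative of a Jacobi polynomial times its weight, at
  parameters (2,2). In the variables \<open>p\<close> and \<open>q\<close>, with
  \<open>p * q\<close> the quarter weight, both sides are sums of monomials. Each monomial on the
  left contributes to two neighbouring ones on the right, and the two contributions carry weights
  \<open>n + 1 - s\<close> and \<open>s\<close>.\<close>

lemma jacobiP22_deriv: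
  "((\<lambda>x. ((x\<^sup>2 - 1) / 4)\<^sup>2 * jacobiP 2 2 n x) has_real_derivative
     real (n + 1) / 2 * ((x\<^sup>2 - 1) / 4 * jacobiP 1 1 (Suc n) x)) (at x)"
proof -
  define p q where "p x = (x - 1) / 2" and "q x = (x + 1) / 2" for x :: real
  define a where "a s = real ((n + 2) choose (n - s)) * real ((n + 2) choose s)" for s
  define b where "b s = real ((n + 2) choose (n + 1 - s)) * real ((n + 2) choose s)" for s
  define P where "P x s = p x ^ (s + 1) * q x ^ (n + 2 - s)" for x s
  have pq: "(x\<^sup>2 - 1) / 4 = p x * q x" for x
    by (simp add: p_def q_def power2_eq_square field_simps)
  \<comment> \<open>Symmetry of the binomial coefficients removes the subtraction in the lower
    index, so that neighbouring coefficients can be compared.\<close>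
  have a: "a s = real ((n + 2) choose (s + 2)) * real ((n + 2) choose s)" if "s \<le> n" for s
    using that binomial_symmetric [of "s + 2" "n + 2"] by (simp add: a_def)
  have b: "b s = real ((n + 2) choose (s + 1)) * real ((n + 2) choose s)" if "s \<le> n + 1" for s
    using that binomial_symmetric [of "s + 1" "n + 2"] by (simp add: b_def)
  have a1: "a s * real (s + 2) = real (n + 1 - s) * b s" if "s \<le> n" for s
  proof -
    have "real (s + 2) * real ((n + 2) choose (s + 2)) = real (n + 1 - s) * real ((n + 2) choose (s + 1))"
      using binomial_step [of "s + 1" "n + 2"] by (simp del: binomial_Suc_Suc)
    then show ?thesis
      using that by (simp add: a b mult_ac del: binomial_Suc_Suc)
  qed
  have a2: "a s * real (n - s + 2) = real (Suc s) * b (Suc s)" if "s \<le> n" for s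
  proof -
    have "real (Suc s) * real ((n + 2) choose Suc s) = real (n + 2 - s) * real ((n + 2) choose s)"
      using binomial_step [of s "n + 2"] by (simp del: binomial_Suc_Suc)
    then show ?thesis
      using that by (simp add: a b mult_ac of_nat_diff del: binomial_Suc_Suc)
  qed
  have lhs: "((x\<^sup>2 - 1) / 4)\<^sup>2 * jacobiP 2 2 n x = (\<Sum>s=0..n. a s * (p x ^ (s + 2) * q x ^ (n - s + 2)))" for x
    unfolding pq jacobiP_def sum_distrib_left
    by (intro sum.cong refl) (simp add: a_def power_add power_mult_distrib power2_eq_square flip: p_def q_def)
  have rhs: "(x\<^sup>2 - 1) / 4 * jacobiP 1 1 (Suc n) x = (\<Sum>s=0..n+1. b s * P x s)" for x
    unfolding pq jacobiP_def sum_distrib_left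
    by (rule sum.cong) (auto simp: b_def P_def Suc_diff_le simp del: binomial_Suc_Suc simp flip: p_def q_def)
  have dp: "(p has_real_derivative 1 / 2) (at x)" and dq: "(q has_real_derivative 1 / 2) (at x)" for x
    unfolding p_def [abs_def] q_def [abs_def] by (auto intro!: derivative_eq_intros)
  have "((\<lambda>x. \<Sum>s=0..n. a s * (p x ^ (s + 2) * q x ^ (n - s + 2))) has_real_derivative
      (\<Sum>s=0..n. a s * (real (s + 2) * p x ^ (s + 1) * (1/2) * q x ^ (n - s + 2)
         + real (n - s + 2) * q x ^ (n - s + 1) * (1/2) * p x ^ (s + 2)))) (at x)"
    by (intro DERIV_sum DERIV_cmult DERIV_mult DERIV_power [OF dp, THEN DERIV_cong]
        DERIV_power [OF dq, THEN DERIV_cong]) auto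
  also have "(\<Sum>s=0..n. a s * (real (s + 2) * p x ^ (s + 1) * (1/2) * q x ^ (n - s + 2)
         + real (n - s + 2) * q x ^ (n - s + 1) * (1/2) * p x ^ (s + 2)))
      = (\<Sum>s=0..n. (1/2) * (a s * real (s + 2) * P x s) + (1/2) * (a s * real (n - s + 2) * P x (Suc s)))"
    by (rule sum.cong) (auto simp: P_def Suc_diff_le algebra_simps)
  also have "\<dots> = (\<Sum>s=0..n. (1/2) * (real (n + 1 - s) * b s * P x s)
      + (1/2) * (real (Suc s) * b (Suc s) * P x (Suc s)))"
    by (intro sum.cong refl) (simp only: a1 a2 atLeastAtMost_iff)
  also have "\<dots> = (1/2) * (\<Sum>s=0..n. real (n + 1 - s) * b s * P x s)
      + (1/2) * (\<Sum>s=0..n. real (Suc s) * b (Suc s) * P x (Suc s))"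
    by (simp only: sum.distrib sum_distrib_left)
  \<comment> \<open>The added term \<open>s = n + 1\<close> has factor 0.\<close>
  also have "(\<Sum>s=0..n. real (n + 1 - s) * b s * P x s) = (\<Sum>s=0..n+1. real (n + 1 - s) * b s * P x s)"
    by simp
  \<comment> \<open>After the index shift the added term \<open>s = 0\<close> has factor 0, so both
    sums now share their range and their weights add up to \<open>n + 1\<close>.\<close>
  also have "(\<Sum>s=0..n. real (Suc s) * b (Suc s) * P x (Suc s)) = (\<Sum>s=0..n+1. real s * b s * P x s)"
    by (simp only: Suc_eq_plus1 [symmetric] sum.atLeast0_atMost_Suc_shift) simp
  also have "(1/2) * (\<Sum>s=0..n+1. real (n + 1 - s) * b s * P x s) + (1/2) * (\<Sum>s=0..n+1. real s * b s * P x s)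
      = (\<Sum>s=0..n+1. real (n + 1) / 2 * (b s * P x s))"
    unfolding sum_distrib_left sum.distrib [symmetric]
    by (rule sum.cong) (auto simp: of_nat_diff algebra_simps add_divide_distrib)
  also have "\<dots> = real (n + 1) / 2 * ((x\<^sup>2 - 1) / 4 * jacobiP 1 1 (Suc n) x)"
    unfolding rhs by (simp only: sum_distrib_left)
  finally show ?thesis
    unfolding lhs .
qed

text \<open>The normalizing constants fit exactly: a factor 2 leaves the square root, and the factor
  \<open>m\<close> in the denominator cancels against the \<open>m / 2\<close> from the Jacobi
  derivative. This exact match makes the velocity basis divergence free.\<close>

lemma vphi_deriv:
  assumes "m \<ge> 1"
  shows "(vphi (m + 3) has_real_derivative psi (m + 2) x) (at x)"
proof -
  \<comment> \<open>With \<open>m\<close> a successor the truncated subtractions in the polynomial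
    degrees become exact.\<close>
  obtain n where m: "m = Suc n"
    using assms by (cases m) auto
  have "sqrt (8 * (2 * real n + 5)) = sqrt (2\<^sup>2 * (2 * (2 * real n + 5)))"
    by (simp add: algebra_simps)
  also have "\<dots> = 2 * sqrt (2 * (2 * real n + 5))"
    by (simp only: real_sqrt_mult real_sqrt_abs)
  finally have "sqrt (8 * (2 * real n + 5)) = 2 * sqrt (2 * (2 * real n + 5))" .
  moreover have "2 * r / (y * z) * (y / 2) = r / z" if "y \<noteq> 0" for r y z :: real
    using that by simp
  ultimately have "sqrt (8 * (2 * real n + 5)) / ((real n + 1) * (real n + 2)) * ((real n + 1) / 2)
      = sqrt (2 * (2 * real n + 5)) / (real n + 2)"
    by (metis add_pos_nonneg less_irrefl of_nat_0_le_iff add.commute zero_less_one)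
  moreover have "2 * real (m + 3) - 3 = 2 * real n + 5" "2 * real (m + 2) - 1 = 2 * real n + 5"
    "real (m + 3) - 3 = real n + 1" "real (m + 3) - 2 = real n + 2" "real (m + 2) - 1 = real n + 2"
    "real (n + 1) = real n + 1"
    by (simp_all add: m)
  ultimately have c: "sqrt (8 * (2 * real (m + 3) - 3)) / ((real (m + 3) - 3) * (real (m + 3) - 2)) * (real (n + 1) / 2)
    = sqrt (2 * (2 * real (m + 2) - 1)) / (real (m + 2) - 1)"
    by (simp only:)
  have index: "m + 3 - 4 = n" "m + 2 - 2 = Suc n"
    by (simp_all add: m)
  have "(vphi (m + 3) has_real_derivative
     sqrt (8 * (2 * real (m + 3) - 3)) / ((real (m + 3) - 3) * (real (m + 3) - 2)) *
      (real (n + 1) / 2 * ((x\<^sup>2 - 1) / 4 * jacobiP 1 1 (Suc n) x))) (at x)"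
    unfolding vphi_def [abs_def] jacobiM2_def index by (rule DERIV_cmult [OF jacobiP22_deriv])
  also have "sqrt (8 * (2 * real (m + 3) - 3)) / ((real (m + 3) - 3) * (real (m + 3) - 2)) *
      (real (n + 1) / 2 * ((x\<^sup>2 - 1) / 4 * jacobiP 1 1 (Suc n) x)) = psi (m + 2) x"
    unfolding psi_def jacobiM1_def c [symmetric] index by (simp only: mult.assoc)
  finally show ?thesis .
qed

section \<open>Regularity and end values of the one-dimensional factors\<close>

lemma jacobiP_differentiable: "jacobiP a b n differentiable at x"
  unfolding jacobiP_def [abs_def]
  by (intro differentiable_sum differentiable_mult differentiable_power) auto

lemma psi_deriv: "\<exists>D. (psi n has_real_derivative D) (at x)"
proof -
  have "psi n differentiable at x"
    unfolding psi_def [abs_def] jacobiM1_def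
    by (intro differentiable_mult jacobiP_differentiable) auto
  then show ?thesis
    by (simp add: real_differentiable_def)
qed

lemma psi_boundary: "psi n 1 = 0" "psi n (-1) = 0" and vphi_boundary: "vphi n 1 = 0" "vphi n (-1) = 0"
  by (simp_all add: psi_def jacobiM1_def vphi_def jacobiM2_def)

lemma bdd_C1_jacobiP: "bounded S \<Longrightarrow> bdd_C1 S (\<lambda>\<xi>. jacobiP a b n (\<xi> $ i))"
  unfolding jacobiP_def by (intro bdd_C1_intros)

lemma
  assumes "bounded S"
  shows bdd_C1_psi: "bdd_C1 S (\<lambda>\<xi>. psi n (\<xi> $ i))"
    and bdd_C1_phi: "bdd_C1 S (\<lambda>\<xi>. phi n (\<xi> $ i))"
    and bdd_C1_vphi: "bdd_C1 S (\<lambda>\<xi>. vphi n (\<xi> $ i))"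
  unfolding psi_def phi_def vphi_def jacobiM1_def jacobiM2_def legendre_def
  by (intro bdd_C1_jacobiP bdd_C1_mult bdd_C1_power bdd_C1_diff bdd_C1_divide_const bdd_C1_const bdd_C1_coord assms)+

section \<open>Reference fields\<close>

definition ref_C1 :: "(real^'n::finite \<Rightarrow> real^'n) set" where
  "ref_C1 = {\<Phi>. \<forall>l. bdd_C1 ref_open_cube (\<lambda>\<xi>. \<Phi> \<xi> $ l)}"

text \<open>What the argument retains of the velocity basis. Both conditions are linear, so they
  pass to spans and to time extrapolations.\<close>

definition ref_solenoidal :: "(real^'n::finite \<Rightarrow> real^'n) set" where
  "ref_solenoidal = {\<Phi>. (\<forall>l. bdd_C1_0 ref_open_cube (\<lambda>\<xi>. \<Phi> \<xi> $ l)) \<and>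
     (\<forall>\<xi>\<in>ref_open_cube. (\<Sum>l\<in>UNIV. pd l (\<lambda>\<zeta>. \<Phi> \<zeta> $ l) \<xi>) = 0)}"

definition fun_subspace :: "('a \<Rightarrow> 'b::real_vector) set \<Rightarrow> bool" where
  "fun_subspace V \<longleftrightarrow> (\<lambda>x. 0) \<in> V \<and>
     (\<forall>f\<in>V. \<forall>g\<in>V. \<forall>a b. (\<lambda>x. a *\<^sub>R f x + b *\<^sub>R g x) \<in> V)"

lemma fun_subspaceD:
  assumes "fun_subspace V"
  shows "(\<lambda>x. 0) \<in> V"
    and "f \<in> V \<Longrightarrow> g \<in> V \<Longrightarrow> (\<lambda>x. a *\<^sub>R f x + b *\<^sub>R g x) \<in> V"
  using assms by (simp_all add: fun_subspace_def)

lemma ref_C1_subspace: "fun_subspace ref_C1"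
  by (auto simp: fun_subspace_def ref_C1_def intro!: bdd_C1_const bdd_C1_add bdd_C1_mult)

lemma ref_solenoidal_subspace: "fun_subspace ref_solenoidal"
  unfolding fun_subspace_def
proof (intro conjI ballI allI)
  show "(\<lambda>x. 0) \<in> ref_solenoidal"
    by (simp add: ref_solenoidal_def bdd_C1_0_zero pd_const)
  fix f g :: "real^'a \<Rightarrow> real^'a" and a b :: real
  assume fg: "f \<in> ref_solenoidal" "g \<in> ref_solenoidal"
  have "(\<Sum>l\<in>UNIV. pd l (\<lambda>\<zeta>. (a *\<^sub>R f \<zeta> + b *\<^sub>R g \<zeta>) $ l) \<xi>) = 0" if "\<xi> \<in> ref_open_cube" for \<xi>
  proof -
    have d: "(\<lambda>\<zeta>. f \<zeta> $ l) differentiable at \<xi>" "(\<lambda>\<zeta>. g \<zeta> $ l) differentiable at \<xi>" for l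
      using fg that by (auto simp: ref_solenoidal_def dest!: bdd_C1_0D intro: bdd_C1D(1))
    have "pd l (\<lambda>\<zeta>. (a *\<^sub>R f \<zeta> + b *\<^sub>R g \<zeta>) $ l) \<xi>
        = a * pd l (\<lambda>\<zeta>. f \<zeta> $ l) \<xi> + b * pd l (\<lambda>\<zeta>. g \<zeta> $ l) \<xi>" for l
      by (simp add: pd_add pd_mult pd_const d differentiable_mult)
    then have "(\<Sum>l\<in>UNIV. pd l (\<lambda>\<zeta>. (a *\<^sub>R f \<zeta> + b *\<^sub>R g \<zeta>) $ l) \<xi>)
        = a * (\<Sum>l\<in>UNIV. pd l (\<lambda>\<zeta>. f \<zeta> $ l) \<xi>) + b * (\<Sum>l\<in>UNIV. pd l (\<lambda>\<zeta>. g \<zeta> $ l) \<xi>)"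
      by (simp add: sum.distrib sum_distrib_left)
    then show ?thesis
      using fg that by (simp add: ref_solenoidal_def)
  qed
  then show "(\<lambda>x. a *\<^sub>R f x + b *\<^sub>R g x) \<in> ref_solenoidal"
    using fg by (auto simp: ref_solenoidal_def intro!: bdd_C1_0_add bdd_C1_0_mult_left bdd_C1_const)
qed

lemma piola_lincomb:
  "piola F (\<lambda>\<xi>. a *\<^sub>R \<Phi> \<xi> + b *\<^sub>R \<Psi> \<xi>) x = a *\<^sub>R piola F \<Phi> x + b *\<^sub>R piola F \<Psi> x"
  by (simp add: piola_def Let_def matrix_vector_right_distrib matrix_vector_mult_scaleR algebra_simps)

lemma fun_subspace_piola:
  assumes "fun_subspace V"
  shows "fun_subspace (piola F ` V)"
  unfolding fun_subspace_def
proof (intro conjI ballI allI)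
  have "(\<lambda>x. 0) = piola F (\<lambda>\<xi>. 0)"
    by (simp add: fun_eq_iff piola_def Let_def)
  then show "(\<lambda>x. 0) \<in> piola F ` V"
    using fun_subspaceD(1) [OF assms] by simp
  fix f g and a b :: real
  assume "f \<in> piola F ` V" "g \<in> piola F ` V"
  then obtain \<Phi> \<Psi> where "\<Phi> \<in> V" "\<Psi> \<in> V" "f = piola F \<Phi>" "g = piola F \<Psi>"
    by blast
  moreover have "(\<lambda>x. a *\<^sub>R piola F \<Phi> x + b *\<^sub>R piola F \<Psi> x) = piola F (\<lambda>\<xi>. a *\<^sub>R \<Phi> \<xi> + b *\<^sub>R \<Psi> \<xi>)"
    by (simp add: piola_lincomb fun_eq_iff)
  ultimately show "(\<lambda>x. a *\<^sub>R f x + b *\<^sub>R g x) \<in> piola F ` V"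
    using fun_subspaceD(2) [OF assms] by simp
qed

lemma fspan_subset:
  assumes V: "fun_subspace V" and "S \<subseteq> V"
  shows "fspan S \<subseteq> V"
proof -
  have "(\<lambda>x. \<Sum>b\<in>S. c b *\<^sub>R b x) \<in> V" for c
    using \<open>S \<subseteq> V\<close>
  \<comment> \<open>Over an infinite \<open>S\<close> the sum is 0 by convention, and the zero
    function lies in \<open>V\<close>.\<close>
  proof (induction S rule: infinite_finite_induct)
    case (insert f S)
    then have "(\<lambda>x. c f *\<^sub>R f x + 1 *\<^sub>R (\<Sum>b\<in>S. c b *\<^sub>R b x)) \<in> V"
      by (intro fun_subspaceD(2) [OF V]) auto
    with insert show ?case
      by simp
  qed (simp_all add: fun_subspaceD(1) [OF V])
  then show ?thesis
    by (auto simp: fspan_def)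
qed

text \<open>The reference fields are polynomials, defined and continuous beyond the cube, so on the
  cube the boundary limit is simply the value on a face.\<close>

lemma bdd_C1_0_ref_open_cubeI:
  assumes "bdd_C1 ref_open_cube f" "\<And>z. f differentiable at z"
    and "\<And>z i. z $ i = 1 \<or> z $ i = -1 \<Longrightarrow> f z = 0"
  shows "bdd_C1_0 ref_open_cube f"
  unfolding bdd_C1_0_def
proof (intro conjI ballI)
  fix z :: "real^'a" assume "z \<in> frontier ref_open_cube"
  then have "f z = 0"
    using assms(3) frontier_ref_open_cubeD by blast
  moreover have "(f \<longlongrightarrow> f z) (at z within ref_open_cube)"
    using assms(2) [of z] differentiable_imp_continuous_within
    by (metis continuous_at_imp_continuous_at_within continuous_within)
  ultimately show "(f \<longlongrightarrow> 0) (at z within ref_open_cube)"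
    by simp
qed (rule assms(1))

section \<open>The velocity basis on the cube\<close>

lemma coord_psi: "(\<lambda>\<xi>. psi n (\<xi> $ i)) differentiable at x"
  and pd_psi_other: "j \<noteq> i \<Longrightarrow> pd j (\<lambda>\<xi>. psi n (\<xi> $ i)) x = 0"
  using psi_deriv [of n "x $ i"] coord_fun by fastforce+

lemma coord_vphi: "m \<ge> 1 \<Longrightarrow> (\<lambda>\<xi>. vphi (m + 3) (\<xi> $ i)) differentiable at x"
  by (rule coord_fun(1) [OF vphi_deriv])

lemma pd_vphi: "m \<ge> 1 \<Longrightarrow> pd i (\<lambda>\<xi>. vphi (m + 3) (\<xi> $ i)) x = psi (m + 2) (x $ i)"
  using coord_fun(2) [OF vphi_deriv, of m i i x] by simp

lemma bdd_C1_0_uminus: "bdd_C1_0 S f \<Longrightarrow> bdd_C1_0 S (\<lambda>x. - f x)"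
  using bdd_C1_0_mult_left [OF bdd_C1_const [of S "-1"]] by simp

lemma pd_uminus:
  fixes f :: "real^'n::finite \<Rightarrow> real"
  assumes "f differentiable at x"
  shows "pd j (\<lambda>x. - f x) x = - pd j f x"
  using pd_mult [of "\<lambda>x. -1" x f j] assms by (simp add: pd_const)

text \<open>The factors that occur in the velocity basis. Each vanishes at both ends of the
  interval, so a product with one factor per coordinate vanishes on every face.\<close>

definition bubble :: "(real \<Rightarrow> real) set" where
  "bubble = range psi \<union> {vphi (m + 3) | m. m \<ge> 1}"

lemma bubble_intros: "psi n \<in> bubble" "m \<ge> 1 \<Longrightarrow> vphi (m + 3) \<in> bubble"
  by (auto simp: bubble_def)

lemma bubbleD:
  assumes "p \<in> bubble"
  shows "p 1 = 0" "p (-1) = 0" "(\<lambda>\<xi>. p (\<xi> $ i)) differentiable at z"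
    "bdd_C1 ref_open_cube (\<lambda>\<xi>. p (\<xi> $ j))"
  using assms psi_boundary vphi_boundary coord_psi coord_vphi
    bdd_C1_psi [OF bounded_ref_open_cube] bdd_C1_vphi [OF bounded_ref_open_cube]
  by (auto simp: bubble_def)

lemma bdd_C1_0_bubble2:
  assumes "p \<in> bubble" "q \<in> bubble"
  shows "bdd_C1_0 ref_open_cube (\<lambda>\<xi>::real^2. p (\<xi> $ 1) * q (\<xi> $ 2))"
proof (rule bdd_C1_0_ref_open_cubeI)
  show "p (z $ 1) * q (z $ 2) = 0" if "z $ i = 1 \<or> z $ i = -1" for z :: "real^2" and i
    using that exhaust_2 [of i] bubbleD(1,2) [OF assms(1)] bubbleD(1,2) [OF assms(2)] by auto
qed (intro bdd_C1_mult differentiable_mult bubbleD assms)+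

lemma bdd_C1_0_bubble3:
  assumes "p \<in> bubble" "q \<in> bubble" "r \<in> bubble"
  shows "bdd_C1_0 ref_open_cube (\<lambda>\<xi>::real^3. p (\<xi> $ 1) * q (\<xi> $ 2) * r (\<xi> $ 3))"
proof (rule bdd_C1_0_ref_open_cubeI)
  show "p (z $ 1) * q (z $ 2) * r (z $ 3) = 0" if "z $ i = 1 \<or> z $ i = -1" for z :: "real^3" and i
    using that exhaust_3 [of i] bubbleD(1,2) [OF assms(1)] bubbleD(1,2) [OF assms(2)]
      bubbleD(1,2) [OF assms(3)] by auto
qed (intro bdd_C1_mult differentiable_mult bubbleD assms)+

text \<open>Differentiating \<open>vphi\<close> in its own variable leaves
  \<open>psi (m + 2)\<close> times \<open>psi (n + 2)\<close> from either component, with opposite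
  signs.\<close>

lemma U2_basis:
  assumes "m \<ge> 1" "n \<ge> 1"
  shows "(\<lambda>\<xi>::real^2. vector [vphi (m+3) (\<xi>$1) * psi (n+2) (\<xi>$2),
    - psi (m+2) (\<xi>$1) * vphi (n+3) (\<xi>$2)]) \<in> ref_solenoidal"
proof -
  have "bdd_C1_0 ref_open_cube (\<lambda>\<xi>::real^2. vphi (m+3) (\<xi>$1) * psi (n+2) (\<xi>$2))"
    "bdd_C1_0 ref_open_cube (\<lambda>\<xi>::real^2. psi (m+2) (\<xi>$1) * vphi (n+3) (\<xi>$2))"
    by (intro bdd_C1_0_bubble2 bubble_intros assms)+
  from this(1) bdd_C1_0_uminus [OF this(2)] assms show ?thesis
    by (simp add: ref_solenoidal_def forall_2 sum_2 pd_uminus pd_mult pd_psi_other pd_vphi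
        coord_psi coord_vphi differentiable_mult)
qed

text \<open>The free index \<open>c\<close> covers two families of the span at once:
  \<open>c = l + 2\<close> and \<open>c = 2\<close>. The factor is constant in the two directions
  that contribute to the divergence.\<close>

lemma U3_basis12:
  assumes "m \<ge> 1" "n \<ge> 1"
  shows "(\<lambda>\<xi>::real^3. vector [vphi (m+3) (\<xi>$1) * psi (n+2) (\<xi>$2) * psi c (\<xi>$3),
    - psi (m+2) (\<xi>$1) * vphi (n+3) (\<xi>$2) * psi c (\<xi>$3), 0]) \<in> ref_solenoidal"
proof -
  have "bdd_C1_0 ref_open_cube (\<lambda>\<xi>::real^3. vphi (m+3) (\<xi>$1) * psi (n+2) (\<xi>$2) * psi c (\<xi>$3))"
    "bdd_C1_0 ref_open_cube (\<lambda>\<xi>::real^3. psi (m+2) (\<xi>$1) * vphi (n+3) (\<xi>$2) * psi c (\<xi>$3))"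
    by (intro bdd_C1_0_bubble3 bubble_intros assms)+
  from this(1) bdd_C1_0_uminus [OF this(2)] assms show ?thesis
    by (simp add: ref_solenoidal_def forall_3 sum_3 pd_uminus pd_mult pd_psi_other pd_vphi pd_const
        coord_psi coord_vphi differentiable_mult bdd_C1_0_zero)
qed

lemma U3_basis13:
  assumes "m \<ge> 1" "l \<ge> 1"
  shows "(\<lambda>\<xi>::real^3. vector [vphi (m+3) (\<xi>$1) * psi c (\<xi>$2) * psi (l+2) (\<xi>$3), 0,
    - psi (m+2) (\<xi>$1) * psi c (\<xi>$2) * vphi (l+3) (\<xi>$3)]) \<in> ref_solenoidal"
proof -
  have "bdd_C1_0 ref_open_cube (\<lambda>\<xi>::real^3. vphi (m+3) (\<xi>$1) * psi c (\<xi>$2) * psi (l+2) (\<xi>$3))"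
    "bdd_C1_0 ref_open_cube (\<lambda>\<xi>::real^3. psi (m+2) (\<xi>$1) * psi c (\<xi>$2) * vphi (l+3) (\<xi>$3))"
    by (intro bdd_C1_0_bubble3 bubble_intros assms)+
  from this(1) bdd_C1_0_uminus [OF this(2)] assms show ?thesis
    by (simp add: ref_solenoidal_def forall_3 sum_3 pd_uminus pd_mult pd_psi_other pd_vphi pd_const
        coord_psi coord_vphi differentiable_mult bdd_C1_0_zero)
qed

lemma U3_basis23:
  assumes "n \<ge> 1" "l \<ge> 1"
  shows "(\<lambda>\<xi>::real^3. vector [0, psi c (\<xi>$1) * vphi (n+3) (\<xi>$2) * psi (l+2) (\<xi>$3),
    - psi c (\<xi>$1) * psi (n+2) (\<xi>$2) * vphi (l+3) (\<xi>$3)]) \<in> ref_solenoidal"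
proof -
  have "bdd_C1_0 ref_open_cube (\<lambda>\<xi>::real^3. psi c (\<xi>$1) * vphi (n+3) (\<xi>$2) * psi (l+2) (\<xi>$3))"
    "bdd_C1_0 ref_open_cube (\<lambda>\<xi>::real^3. psi c (\<xi>$1) * psi (n+2) (\<xi>$2) * vphi (l+3) (\<xi>$3))"
    by (intro bdd_C1_0_bubble3 bubble_intros assms)+
  from this(1) bdd_C1_0_uminus [OF this(2)] assms show ?thesis
    by (simp add: ref_solenoidal_def forall_3 sum_3 pd_uminus pd_mult pd_psi_other pd_vphi pd_const
        coord_psi coord_vphi differentiable_mult bdd_C1_0_zero)
qed

section \<open>The discrete spaces as Piola images\<close>

lemma U2_subset: "U2 F N \<subseteq> piola F ` ref_solenoidal"
  unfolding U2_def
  by (intro fspan_subset fun_subspace_piola ref_solenoidal_subspace subsetI, clarify, intro imageI U2_basis) auto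

lemma U3_subset: "U3 F N \<subseteq> piola F ` ref_solenoidal"
  unfolding U3_def
  by (intro fspan_subset fun_subspace_piola ref_solenoidal_subspace UN_least image_mono insert_subsetI
      empty_subsetI U3_basis12 U3_basis13 U3_basis23) auto

lemma W2_subset: "W2 F N \<subseteq> piola F ` ref_C1"
  unfolding W2_def
proof (intro fspan_subset fun_subspace_piola ref_C1_subspace subsetI, clarify, rule imageI)
  fix m n
  show "(\<lambda>\<xi>::real^2. vector [psi (m+1) (\<xi>$1) * phi n (\<xi>$2), - phi m (\<xi>$1) * psi (n+1) (\<xi>$2)]) \<in> ref_C1"
    by (auto simp: ref_C1_def forall_2
        intro!: bdd_C1_mult bdd_C1_minus bdd_C1_psi bdd_C1_phi bounded_ref_open_cube)
qed

lemma W3_subset: "W3 F N \<subseteq> piola F ` ref_C1"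
  unfolding W3_def
  by (intro fspan_subset fun_subspace_piola ref_C1_subspace UN_least image_mono insert_subsetI
      empty_subsetI)
    (auto simp: ref_C1_def forall_3
        intro!: bdd_C1_mult bdd_C1_minus bdd_C1_psi bdd_C1_phi bdd_C1_const bounded_ref_open_cube)

section \<open>Energy identities\<close>

lemma curl2_by_parts:
  fixes S :: "(real^2) set"
  assumes S: "open S" "bounded S" "negligible (frontier S)"
    and c: "bdd_C1_0 S c" and B: "\<And>i. bdd_C1 S (\<lambda>x. B x $ i)"
  shows "L2ip S (curl2s c) B = integral S (\<lambda>x. c x * curl2v B x)"
proof -
  note int = bdd_C1_integrable(2,3) [OF S(1,2) bdd_C1_0D [OF c] B, THEN set_lebesgue_integral_eq_integral(1)]
  have "L2ip S (curl2s c) B = integral S (\<lambda>x. pd 2 c x * B x $ 1 - pd 1 c x * B x $ 2)"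
    by (simp add: L2ip_def curl2s_def inner_vec_def sum_2)
  also have "\<dots> = integral S (\<lambda>x. c x * pd 1 (\<lambda>y. B y $ 2) x - c x * pd 2 (\<lambda>y. B y $ 1) x)"
    by (simp add: integral_diff int integration_by_parts_pd [OF S c B])
  finally show ?thesis
    by (simp add: curl2v_def algebra_simps)
qed

text \<open>The curl is formally self-adjoint. Six scalar integrations by parts are used, each with
  a component of \<open>w\<close> as the vanishing factor.\<close>

lemma curl3_by_parts:
  fixes S :: "(real^3) set"
  assumes S: "open S" "bounded S" "negligible (frontier S)"
    and w: "\<And>i. bdd_C1_0 S (\<lambda>x. w x $ i)" and B: "\<And>i. bdd_C1 S (\<lambda>x. B x $ i)"
  shows "L2ip S (curl3 w) B = L2ip S w (curl3 B)"
proof -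
  note int = bdd_C1_integrable(2,3) [OF S(1,2) bdd_C1_0D [OF w] B, THEN set_lebesgue_integral_eq_integral(1)]
  have "L2ip S (curl3 w) B = integral S (\<lambda>x.
      (pd 2 (\<lambda>y. w y $ 3) x * B x $ 1 - pd 3 (\<lambda>y. w y $ 2) x * B x $ 1)
    + (pd 3 (\<lambda>y. w y $ 1) x * B x $ 2 - pd 1 (\<lambda>y. w y $ 3) x * B x $ 2)
    + (pd 1 (\<lambda>y. w y $ 2) x * B x $ 3 - pd 2 (\<lambda>y. w y $ 1) x * B x $ 3))"
    by (simp add: L2ip_def curl3_def inner_vec_def sum_3 left_diff_distrib)
  also have "\<dots> = integral S (\<lambda>x.
      (w x $ 1 * pd 2 (\<lambda>y. B y $ 3) x - w x $ 1 * pd 3 (\<lambda>y. B y $ 2) x)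
    + (w x $ 2 * pd 3 (\<lambda>y. B y $ 1) x - w x $ 2 * pd 1 (\<lambda>y. B y $ 3) x)
    + (w x $ 3 * pd 1 (\<lambda>y. B y $ 2) x - w x $ 3 * pd 2 (\<lambda>y. B y $ 1) x))"
    by (simp add: integral_diff integral_add integrable_diff integrable_add int
        integration_by_parts_pd [OF S w B])
  finally show ?thesis
    by (simp add: L2ip_def curl3_def inner_vec_def sum_3 right_diff_distrib)
qed

section \<open>Bilinear algebra of the inner product and the BDF identities\<close>

definition vec_C1 :: "(real^'n::finite) set \<Rightarrow> (real^'n \<Rightarrow> real^'n) \<Rightarrow> bool" where
  "vec_C1 S f \<longleftrightarrow> (\<forall>i. bdd_C1 S (\<lambda>x. f x $ i))"

lemma vec_C1_intros:
  assumes "vec_C1 S f"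
  shows "vec_C1 S (\<lambda>x. c *\<^sub>R f x)"
    and "vec_C1 S g \<Longrightarrow> vec_C1 S (\<lambda>x. f x + g x)"
    and "vec_C1 S g \<Longrightarrow> vec_C1 S (\<lambda>x. f x - g x)"
  using assms by (auto simp: vec_C1_def intro!: bdd_C1_mult bdd_C1_add bdd_C1_diff bdd_C1_const)

lemma vec_C1_integrable:
  assumes "open S" "bounded S" "vec_C1 S f" "vec_C1 S g"
  shows "(\<lambda>x. f x \<bullet> g x) integrable_on S"
proof -
  have "(\<lambda>x. f x $ i * g x $ i) integrable_on S" for i
    using assms by (intro set_lebesgue_integral_eq_integral(1) bdd_C1_integrable(1)) (auto simp: vec_C1_def)
  then show ?thesis
    by (simp add: inner_vec_def integrable_sum)
qed

lemma L2ip_commute: "L2ip S f g = L2ip S g f"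
  by (simp add: L2ip_def inner_commute)

lemma L2ip_linear:
  assumes S: "open S" "bounded S"
  shows "L2ip S (\<lambda>x. c *\<^sub>R f x) h = c * L2ip S f h"
    and "vec_C1 S f \<Longrightarrow> vec_C1 S g \<Longrightarrow> vec_C1 S h \<Longrightarrow>
      L2ip S (\<lambda>x. f x + g x) h = L2ip S f h + L2ip S g h"
    and "vec_C1 S f \<Longrightarrow> vec_C1 S g \<Longrightarrow> vec_C1 S h \<Longrightarrow>
      L2ip S (\<lambda>x. f x - g x) h = L2ip S f h - L2ip S g h"
  by (simp_all add: L2ip_def inner_add_left inner_diff_left integral_add integral_diff
      vec_C1_integrable [OF S])

lemma L2ip_linear_right:
  assumes S: "open S" "bounded S"
  shows "L2ip S h (\<lambda>x. c *\<^sub>R f x) = c * L2ip S h f"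
    and "vec_C1 S f \<Longrightarrow> vec_C1 S g \<Longrightarrow> vec_C1 S h \<Longrightarrow>
      L2ip S h (\<lambda>x. f x + g x) = L2ip S h f + L2ip S h g"
    and "vec_C1 S f \<Longrightarrow> vec_C1 S g \<Longrightarrow> vec_C1 S h \<Longrightarrow>
      L2ip S h (\<lambda>x. f x - g x) = L2ip S h f - L2ip S h g"
  by (simp_all add: L2ip_commute [of S h] L2ip_linear [OF S])

text \<open>The G-stability identity of BDF2, with \<open>a\<close>, \<open>b\<close>,
  \<open>c\<close> the new, current and previous levels. Both sides expand into inner products of
  these three, and symmetry makes the coefficients agree.\<close>

lemma BDF2_identity:
  assumes S: "open S" "bounded S" and abc: "vec_C1 S a" "vec_C1 S b" "vec_C1 S c"
  shows "4 * L2ip S (\<lambda>x. (3/2) *\<^sub>R a x - (2 *\<^sub>R b x - (1/2) *\<^sub>R c x)) a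
    = L2sq S a + L2sq S (\<lambda>x. 2 *\<^sub>R a x - b x) - L2sq S b - L2sq S (\<lambda>x. 2 *\<^sub>R b x - c x)
      + L2sq S (\<lambda>x. a x - 2 *\<^sub>R b x + c x)"
proof -
  have "L2ip S b a = L2ip S a b" "L2ip S c a = L2ip S a c" "L2ip S c b = L2ip S b c"
    by (rule L2ip_commute)+
  then show ?thesis
    by (simp add: L2sq_def L2ip_linear [OF S] L2ip_linear_right [OF S] abc vec_C1_intros algebra_simps)
qed

lemma BDF1_identity:
  assumes S: "open S" "bounded S" and ab: "vec_C1 S a" "vec_C1 S b"
  shows "2 * L2ip S (\<lambda>x. a x - b x) a = L2sq S a - L2sq S b + L2sq S (\<lambda>x. a x - b x)"
  using L2ip_commute [of S b a]
  by (simp add: L2sq_def L2ip_linear [OF S] L2ip_linear_right [OF S] ab vec_C1_intros)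

lemma energy_balance:
  assumes S: "open S" "bounded S" and k: "k \<in> {1, 2}" "k - 1 \<le> n"
    and u: "\<And>j. j \<in> {0..k} \<Longrightarrow> vec_C1 S (u (n + 1 - j))"
    and B: "\<And>j. j \<in> {0..k} \<Longrightarrow> vec_C1 S (B (n + 1 - j))"
  shows "energy S k \<tau> \<mu> \<rho> u B (n + 1) - energy S k \<tau> \<mu> \<rho> u B n + dissip S k \<tau> \<mu> \<rho> u B (n + 1)
    = 1 / \<tau> * L2ip S (\<lambda>x. bdf_gamma k *\<^sub>R u (n + 1) x - bdf_hat k u n x) (u (n + 1))
      + 1 / (\<mu> * \<rho>) * (1 / \<tau> * L2ip S (\<lambda>x. bdf_gamma k *\<^sub>R B (n + 1) x - bdf_hat k B n x) (B (n + 1)))"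
proof (cases "k = 1")
  case True
  then have u': "vec_C1 S (u (n + 1))" "vec_C1 S (u n)" and B': "vec_C1 S (B (n + 1))" "vec_C1 S (B n)"
    using u [of 0] u [of 1] B [of 0] B [of 1] by auto
  have e: "L2ip S (\<lambda>x. w (n + 1) x - w n x) (w (n + 1))
      = (L2sq S (w (n + 1)) - L2sq S (w n) + L2sq S (\<lambda>x. w (n + 1) x - w n x)) / 2"
    if "vec_C1 S (w (n + 1))" "vec_C1 S (w n)" for w
    using BDF1_identity [OF S that] by simp
  have "L2ip S (\<lambda>x. bdf_gamma k *\<^sub>R w (n + 1) x - bdf_hat k w n x) (w (n + 1))
      = (L2sq S (w (n + 1)) - L2sq S (w n) + L2sq S (\<lambda>x. w (n + 1) x - w n x)) / 2"
    if "vec_C1 S (w (n + 1))" "vec_C1 S (w n)" for w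
    using e [of w, OF that] True by (simp add: bdf_gamma_def bdf_hat_def)
  from this [of u, OF u'] this [of B, OF B'] show ?thesis
    by (simp only:) (simp add: True energy_def dissip_def algebra_simps add_divide_distrib diff_divide_distrib)
next
  case False
  then have k: "k = 2" "n \<ge> 1"
    using k by auto
  then have u': "vec_C1 S (u (n + 1))" "vec_C1 S (u n)" "vec_C1 S (u (n - 1))"
    and B': "vec_C1 S (B (n + 1))" "vec_C1 S (B n)" "vec_C1 S (B (n - 1))"
    using u [of 0] u [of 1] u [of 2] B [of 0] B [of 1] B [of 2] by auto
  have e: "L2ip S (\<lambda>x. bdf_gamma k *\<^sub>R w (n + 1) x - bdf_hat k w n x) (w (n + 1))
    = (L2sq S (w (n + 1)) + L2sq S (\<lambda>x. 2 *\<^sub>R w (n + 1) x - w n x) - L2sq S (w n)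
      - L2sq S (\<lambda>x. 2 *\<^sub>R w n x - w (n - 1) x)
      + L2sq S (\<lambda>x. w (n + 1) x - 2 *\<^sub>R w n x + w (n - 1) x)) / 4"
    if "vec_C1 S (w (n + 1))" "vec_C1 S (w n)" "vec_C1 S (w (n - 1))" for w
    using BDF2_identity [OF S that] by (simp add: k bdf_gamma_def bdf_hat_def)
  have n: "n + 1 - 1 = n" "n + 1 - 2 = n - 1"
    using k by auto
  show ?thesis
    unfolding e [of u, OF u'] e [of B, OF B'] unfolding energy_def dissip_def n k
    by (simp add: algebra_simps add_divide_distrib diff_divide_distrib)
qed

text \<open>Applied to the velocity this keeps the transporting field solenoidal, and applied to the
  magnetic field it keeps the regularity needed in the coupling.\<close>

lemma bdf_tilde_mem:
  assumes V: "fun_subspace V" and "w n \<in> V" "k \<noteq> 1 \<Longrightarrow> w (n - 1) \<in> V"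
  shows "bdf_tilde k w n \<in> V"
proof (cases "k = 1")
  case False
  with assms have "(\<lambda>x. 2 *\<^sub>R w n x + (-1) *\<^sub>R w (n - 1) x) \<in> V"
    by (intro fun_subspaceD(2) [OF V]) auto
  with False show ?thesis
    by (simp add: bdf_tilde_def)
qed (use assms in \<open>simp add: bdf_tilde_def\<close>)

section \<open>The energy law for an abstract coupling term\<close>

context cube_diffeo
begin

lemma piola_ref_solenoidalD:
  assumes "f \<in> piola F ` ref_solenoidal"
  shows "bdd_C1_0 \<Omega> (\<lambda>x. f x $ i)" "f \<in> piola F ` ref_C1"
  using assms by (auto simp: ref_solenoidal_def ref_C1_def intro: bdd_C1_0_piola bdd_C1_0D)

lemma piola_ref_C1D:
  assumes "f \<in> piola F ` ref_C1"
  shows "bdd_C1 \<Omega> (\<lambda>x. f x $ i)" "vec_C1 \<Omega> f"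
  using assms by (auto simp: vec_C1_def ref_C1_def intro: bdd_C1_piola)

text \<open>\<open>C\<close> is the coupling term: the Lorentz force tested with the velocity and the induction term
  tested with the magnetic field are both expressed through it, with opposite signs.\<close>
lemma energy_law:
  assumes k: "k \<in> {1, 2}" "k - 1 \<le> n"
    and u: "\<And>j. j \<in> {0..k} \<Longrightarrow> u (n + 1 - j) \<in> piola F ` ref_solenoidal"
    and B: "\<And>j. j \<in> {0..k} \<Longrightarrow> B (n + 1 - j) \<in> piola F ` ref_C1"
    and mom: "1 / \<tau> * L2ip \<Omega> (\<lambda>x. bdf_gamma k *\<^sub>R u (n + 1) x - bdf_hat k u n x) (u (n + 1))
        + L2ip \<Omega> (conv (bdf_tilde k u n) (u (n + 1))) (u (n + 1)) + \<nu> * g = 1 / (\<mu> * \<rho>) * (- C)"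
    and ind: "1 / \<tau> * L2ip \<Omega> (\<lambda>x. bdf_gamma k *\<^sub>R B (n + 1) x - bdf_hat k B n x) (B (n + 1))
        + \<eta> * h - C = 0"
  shows "energy \<Omega> k \<tau> \<mu> \<rho> u B (n + 1) - energy \<Omega> k \<tau> \<mu> \<rho> u B n
    = - dissip \<Omega> k \<tau> \<mu> \<rho> u B (n + 1) - \<nu> * g - \<eta> / (\<mu> * \<rho>) * h"
proof -
  have u1: "u (n + 1) \<in> piola F ` ref_solenoidal"
    using u [of 0] by simp
  have "bdf_tilde k u n \<in> piola F ` ref_solenoidal"
  proof (rule bdf_tilde_mem [OF fun_subspace_piola [OF ref_solenoidal_subspace]])
    show "u n \<in> piola F ` ref_solenoidal"
      using u [of 1] k by auto
    show "u (n - 1) \<in> piola F ` ref_solenoidal" if "k \<noteq> 1"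
      using u [of 2] k that by auto
  qed
  with u1 have "L2ip \<Omega> (conv (bdf_tilde k u n) (u (n + 1))) (u (n + 1)) = 0"
    by (auto simp: ref_solenoidal_def intro!: convection_orthogonal bdd_C1_0D)
  with mom have X: "1 / \<tau> * L2ip \<Omega> (\<lambda>x. bdf_gamma k *\<^sub>R u (n + 1) x - bdf_hat k u n x) (u (n + 1))
      = - (1 / (\<mu> * \<rho>) * C) - \<nu> * g"
    by simp
  have Y: "1 / \<tau> * L2ip \<Omega> (\<lambda>x. bdf_gamma k *\<^sub>R B (n + 1) x - bdf_hat k B n x) (B (n + 1)) = C - \<eta> * h"
    using ind by linarith
  \<comment> \<open>The magnetic part of the balance carries the weight
    \<open>1 / (\<mu> * \<rho>)\<close>, so inserting \<open>X\<close> and \<open>Y\<close> removes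
    \<open>C\<close>.\<close>
  have "energy \<Omega> k \<tau> \<mu> \<rho> u B (n + 1) - energy \<Omega> k \<tau> \<mu> \<rho> u B n + dissip \<Omega> k \<tau> \<mu> \<rho> u B (n + 1)
    = 1 / \<tau> * L2ip \<Omega> (\<lambda>x. bdf_gamma k *\<^sub>R u (n + 1) x - bdf_hat k u n x) (u (n + 1))
      + 1 / (\<mu> * \<rho>) * (1 / \<tau> * L2ip \<Omega> (\<lambda>x. bdf_gamma k *\<^sub>R B (n + 1) x - bdf_hat k B n x) (B (n + 1)))"
    using u B piola_ref_solenoidalD(2) piola_ref_C1D(2)
    by (intro energy_balance [OF open_dom bounded_dom k]) blast+
  then show ?thesis
    unfolding X Y by (simp add: right_diff_distrib diff_divide_distrib)
qed

end

text \<open>Antisymmetry of the triple product, pointwise in the integrand; the sign leaves the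
  integral without any integrability condition.\<close>

lemma lorentz_coupling2:
  "L2ip S (\<lambda>x. cross2sv (c x) (b x)) u = - integral S (\<lambda>x. cross2vv (u x) (b x) * c x)"
  unfolding L2ip_def integral_neg [symmetric]
  by (intro integral_cong) (simp add: cross2sv_def cross2vv_def inner_vec_def sum_2 algebra_simps)

lemma lorentz_coupling3:
  "L2ip S (\<lambda>x. cross3 (c x) (b x)) u = - L2ip S (\<lambda>x. cross3 (u x) (b x)) c"
  unfolding L2ip_def integral_neg [symmetric]
  by (intro integral_cong) (simp add: cross3_def inner_vec_def sum_3 algebra_simps)

lemma bdd_C1_0_cross2:
  assumes "\<And>i. bdd_C1_0 S (\<lambda>x. u x $ i)" "\<And>i. bdd_C1 S (\<lambda>x. b x $ i)"
  shows "bdd_C1_0 S (\<lambda>x. cross2vv (u x) (b x))"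
  unfolding cross2vv_def by (intro bdd_C1_0_diff bdd_C1_0_mult assms)

lemma bdd_C1_0_cross3:
  assumes "\<And>i. bdd_C1_0 S (\<lambda>x. u x $ i)" "\<And>i. bdd_C1 S (\<lambda>x. b x $ i)"
  shows "bdd_C1_0 S (\<lambda>x. cross3 (u x) (b x) $ i)"
proof -
  have "\<forall>i. bdd_C1_0 S (\<lambda>x. cross3 (u x) (b x) $ i)"
    unfolding forall_3 cross3_def vector_3 by (intro conjI bdd_C1_0_diff bdd_C1_0_mult assms)
  then show ?thesis
    by blast
qed

section \<open>The planar and spatial cases\<close>

lemma energy_law_2D:
  fixes F :: "real^2 \<Rightarrow> real^2"
  assumes F: "smooth_diffeo_cube F" and k: "k \<in> {1, 2}" "k - 1 \<le> n"
    and u: "\<And>j. j \<in> {0..k} \<Longrightarrow> u (n + 1 - j) \<in> U2 F N"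
    and B: "\<And>j. j \<in> {0..k} \<Longrightarrow> B (n + 1 - j) \<in> W2 F N"
    and mom: "\<forall>v\<in>U2 F N.
        1 / \<tau> * L2ip (dom_of F) (\<lambda>x. bdf_gamma k *\<^sub>R u (n + 1) x - bdf_hat k u n x) v
        + L2ip (dom_of F) (conv (bdf_tilde k u n) (u (n + 1))) v
        + \<nu> * grad_ip (dom_of F) (u (n + 1)) v
      = 1 / (\<mu> * \<rho>) * L2ip (dom_of F) (\<lambda>x. cross2sv (curl2v (B (n + 1)) x) (bdf_tilde k B n x)) v
        + L2ip (dom_of F) (\<lambda>x. 0) v"
    and ind: "\<forall>\<Phi>\<in>W2 F N.
        1 / \<tau> * L2ip (dom_of F) (\<lambda>x. bdf_gamma k *\<^sub>R B (n + 1) x - bdf_hat k B n x) \<Phi>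
        + \<eta> * L2ip (dom_of F) (curl2v (B (n + 1))) (curl2v \<Phi>)
        - L2ip (dom_of F) (curl2s (\<lambda>x. cross2vv (u (n + 1) x) (bdf_tilde k B n x))) \<Phi> = 0"
  shows "energy (dom_of F) k \<tau> \<mu> \<rho> u B (n + 1) - energy (dom_of F) k \<tau> \<mu> \<rho> u B n
     = - dissip (dom_of F) k \<tau> \<mu> \<rho> u B (n + 1)
       - \<nu> * grad_ip (dom_of F) (u (n + 1)) (u (n + 1))
       - \<eta> / (\<mu> * \<rho>) * L2sq (dom_of F) (curl2v (B (n + 1)))"
proof -
  interpret cube_diffeo F
    using F by unfold_locales
  have u': "u (n + 1 - j) \<in> piola F ` ref_solenoidal"
    and B': "B (n + 1 - j) \<in> piola F ` ref_C1" if "j \<in> {0..k}" for j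
    using u [OF that] B [OF that] U2_subset W2_subset by blast+
  have "bdf_tilde k B n \<in> piola F ` ref_C1"
  proof (rule bdf_tilde_mem [OF fun_subspace_piola [OF ref_C1_subspace]])
    show "B n \<in> piola F ` ref_C1"
      using B' [of 1] k by auto
    show "B (n - 1) \<in> piola F ` ref_C1" if "k \<noteq> 1"
      using B' [of 2] k that by auto
  qed
  then have "bdd_C1_0 \<Omega> (\<lambda>x. cross2vv (u (n + 1) x) (bdf_tilde k B n x))"
    using piola_ref_solenoidalD(1) [OF u' [of 0]] by (intro bdd_C1_0_cross2 piola_ref_C1D(1)) auto
  then have induction: "L2ip \<Omega> (curl2s (\<lambda>x. cross2vv (u (n + 1) x) (bdf_tilde k B n x))) (B (n + 1))
      = integral \<Omega> (\<lambda>x. cross2vv (u (n + 1) x) (bdf_tilde k B n x) * curl2v (B (n + 1)) x)"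
    using piola_ref_C1D(1) [OF B' [of 0]]
    by (intro curl2_by_parts open_dom bounded_dom negligible_frontier_dom) auto
  have lorentz: "L2ip \<Omega> (\<lambda>x. cross2sv (curl2v (B (n + 1)) x) (bdf_tilde k B n x)) (u (n + 1))
      = - integral \<Omega> (\<lambda>x. cross2vv (u (n + 1) x) (bdf_tilde k B n x) * curl2v (B (n + 1)) x)"
    by (rule lorentz_coupling2)
  have "u (n + 1) \<in> U2 F N" "B (n + 1) \<in> W2 F N"
    using u [of 0] B [of 0] by auto
  \<comment> \<open>After rewriting, the tested equations share one integral of the electromotive
    term against the curl, which unification takes as the coupling constant
    \<open>C\<close>.\<close>
  from bspec [OF mom this(1)] bspec [OF ind this(2)] show ?thesis
    unfolding L2sq_def induction lorentz
    by (intro energy_law [where n = n and u = u and B = B, OF k u' B'])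
      (simp_all only: L2ip_def [of _ "\<lambda>x. 0"] inner_zero_left integral_0 add_0_right)
qed

lemma energy_law_3D:
  fixes F :: "real^3 \<Rightarrow> real^3"
  assumes F: "smooth_diffeo_cube F" and k: "k \<in> {1, 2}" "k - 1 \<le> n"
    and u: "\<And>j. j \<in> {0..k} \<Longrightarrow> u (n + 1 - j) \<in> U3 F N"
    and B: "\<And>j. j \<in> {0..k} \<Longrightarrow> B (n + 1 - j) \<in> W3 F N"
    and mom: "\<forall>v\<in>U3 F N.
        1 / \<tau> * L2ip (dom_of F) (\<lambda>x. bdf_gamma k *\<^sub>R u (n + 1) x - bdf_hat k u n x) v
        + L2ip (dom_of F) (conv (bdf_tilde k u n) (u (n + 1))) v
        + \<nu> * grad_ip (dom_of F) (u (n + 1)) v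
      = 1 / (\<mu> * \<rho>) * L2ip (dom_of F) (\<lambda>x. cross3 (curl3 (B (n + 1)) x) (bdf_tilde k B n x)) v
        + L2ip (dom_of F) (\<lambda>x. 0) v"
    and ind: "\<forall>\<Phi>\<in>W3 F N.
        1 / \<tau> * L2ip (dom_of F) (\<lambda>x. bdf_gamma k *\<^sub>R B (n + 1) x - bdf_hat k B n x) \<Phi>
        + \<eta> * L2ip (dom_of F) (curl3 (B (n + 1))) (curl3 \<Phi>)
        - L2ip (dom_of F) (curl3 (\<lambda>x. cross3 (u (n + 1) x) (bdf_tilde k B n x))) \<Phi> = 0"
  shows "energy (dom_of F) k \<tau> \<mu> \<rho> u B (n + 1) - energy (dom_of F) k \<tau> \<mu> \<rho> u B n
     = - dissip (dom_of F) k \<tau> \<mu> \<rho> u B (n + 1)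
       - \<nu> * grad_ip (dom_of F) (u (n + 1)) (u (n + 1))
       - \<eta> / (\<mu> * \<rho>) * L2sq (dom_of F) (curl3 (B (n + 1)))"
proof -
  interpret cube_diffeo F
    using F by unfold_locales
  have u': "u (n + 1 - j) \<in> piola F ` ref_solenoidal"
    and B': "B (n + 1 - j) \<in> piola F ` ref_C1" if "j \<in> {0..k}" for j
    using u [OF that] B [OF that] U3_subset W3_subset by blast+
  have "bdf_tilde k B n \<in> piola F ` ref_C1"
  proof (rule bdf_tilde_mem [OF fun_subspace_piola [OF ref_C1_subspace]])
    show "B n \<in> piola F ` ref_C1"
      using B' [of 1] k by auto
    show "B (n - 1) \<in> piola F ` ref_C1" if "k \<noteq> 1"
      using B' [of 2] k that by auto
  qed
  then have "bdd_C1_0 \<Omega> (\<lambda>x. cross3 (u (n + 1) x) (bdf_tilde k B n x) $ i)" for i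
    using piola_ref_solenoidalD(1) [OF u' [of 0]] by (intro bdd_C1_0_cross3 piola_ref_C1D(1)) auto
  then have induction: "L2ip \<Omega> (curl3 (\<lambda>x. cross3 (u (n + 1) x) (bdf_tilde k B n x))) (B (n + 1))
      = L2ip \<Omega> (\<lambda>x. cross3 (u (n + 1) x) (bdf_tilde k B n x)) (curl3 (B (n + 1)))"
    using piola_ref_C1D(1) [OF B' [of 0]]
    by (intro curl3_by_parts open_dom bounded_dom negligible_frontier_dom) auto
  have lorentz: "L2ip \<Omega> (\<lambda>x. cross3 (curl3 (B (n + 1)) x) (bdf_tilde k B n x)) (u (n + 1))
      = - L2ip \<Omega> (\<lambda>x. cross3 (u (n + 1) x) (bdf_tilde k B n x)) (curl3 (B (n + 1)))"
    by (rule lorentz_coupling3)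
  have "u (n + 1) \<in> U3 F N" "B (n + 1) \<in> W3 F N"
    using u [of 0] B [of 0] by auto
  \<comment> \<open>Here the shared coupling constant is the inner product of \<open>cross3\<close>
    of velocity and extrapolated field with the curl of the new magnetic field.\<close>
  from bspec [OF mom this(1)] bspec [OF ind this(2)] show ?thesis
    unfolding L2sq_def induction lorentz
    by (intro energy_law [where n = n and u = u and B = B, OF k u' B'])
      (simp_all only: L2ip_def [of _ "\<lambda>x. 0"] inner_zero_left integral_0 add_0_right)
qed

theorem theorem3p1:
  shows
  "(\<forall>(F::real^2 \<Rightarrow> real^2) (N::nat) (\<nu>::real) (\<eta>::real) (\<mu>::real) (\<rho>::real) (\<tau>::real)
      (k::nat) (n::nat) (u::nat \<Rightarrow> real^2 \<Rightarrow> real^2) (B::nat \<Rightarrow> real^2 \<Rightarrow> real^2)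
      (f::nat \<Rightarrow> real^2 \<Rightarrow> real^2).
     smooth_diffeo_cube F \<and> N \<ge> 4 \<and>
     \<nu> > 0 \<and> \<eta> > 0 \<and> \<mu> > 0 \<and> \<rho> > 0 \<and> \<tau> > 0 \<and> k \<in> {1, 2} \<and> n \<ge> k - 1 \<and>
     (\<forall>j\<in>{1..k}. u (n + 1 - j) \<in> U2 F N \<and> B (n + 1 - j) \<in> W2 F N) \<and>
     u (n + 1) \<in> U2 F N \<and> B (n + 1) \<in> W2 F N \<and>
     f (n + 1) = (\<lambda>x. 0) \<and>
     (\<forall>v\<in>U2 F N.
        1 / \<tau> * L2ip (dom_of F) (\<lambda>x. bdf_gamma k *\<^sub>R u (n + 1) x - bdf_hat k u n x) v
        + L2ip (dom_of F) (conv (bdf_tilde k u n) (u (n + 1))) v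
        + \<nu> * grad_ip (dom_of F) (u (n + 1)) v
      = 1 / (\<mu> * \<rho>) * L2ip (dom_of F) (\<lambda>x. cross2sv (curl2v (B (n + 1)) x) (bdf_tilde k B n x)) v
        + L2ip (dom_of F) (f (n + 1)) v) \<and>
     (\<forall>\<Phi>\<in>W2 F N.
        1 / \<tau> * L2ip (dom_of F) (\<lambda>x. bdf_gamma k *\<^sub>R B (n + 1) x - bdf_hat k B n x) \<Phi>
        + \<eta> * L2ip (dom_of F) (curl2v (B (n + 1))) (curl2v \<Phi>)
        - L2ip (dom_of F) (curl2s (\<lambda>x. cross2vv (u (n + 1) x) (bdf_tilde k B n x))) \<Phi> = 0)
     \<longrightarrow>
     energy (dom_of F) k \<tau> \<mu> \<rho> u B (n + 1) - energy (dom_of F) k \<tau> \<mu> \<rho> u B n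
     = - dissip (dom_of F) k \<tau> \<mu> \<rho> u B (n + 1)
       - \<nu> * grad_ip (dom_of F) (u (n + 1)) (u (n + 1))
       - \<eta> / (\<mu> * \<rho>) * L2sq (dom_of F) (curl2v (B (n + 1))))
   \<and>
   (\<forall>(F::real^3 \<Rightarrow> real^3) (N::nat) (\<nu>::real) (\<eta>::real) (\<mu>::real) (\<rho>::real) (\<tau>::real)
      (k::nat) (n::nat) (u::nat \<Rightarrow> real^3 \<Rightarrow> real^3) (B::nat \<Rightarrow> real^3 \<Rightarrow> real^3)
      (f::nat \<Rightarrow> real^3 \<Rightarrow> real^3).
     smooth_diffeo_cube F \<and> N \<ge> 4 \<and>
     \<nu> > 0 \<and> \<eta> > 0 \<and> \<mu> > 0 \<and> \<rho> > 0 \<and> \<tau> > 0 \<and> k \<in> {1, 2} \<and> n \<ge> k - 1 \<and>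
     (\<forall>j\<in>{1..k}. u (n + 1 - j) \<in> U3 F N \<and> B (n + 1 - j) \<in> W3 F N) \<and>
     u (n + 1) \<in> U3 F N \<and> B (n + 1) \<in> W3 F N \<and>
     f (n + 1) = (\<lambda>x. 0) \<and>
     (\<forall>v\<in>U3 F N.
        1 / \<tau> * L2ip (dom_of F) (\<lambda>x. bdf_gamma k *\<^sub>R u (n + 1) x - bdf_hat k u n x) v
        + L2ip (dom_of F) (conv (bdf_tilde k u n) (u (n + 1))) v
        + \<nu> * grad_ip (dom_of F) (u (n + 1)) v
      = 1 / (\<mu> * \<rho>) * L2ip (dom_of F) (\<lambda>x. cross3 (curl3 (B (n + 1)) x) (bdf_tilde k B n x)) v
        + L2ip (dom_of F) (f (n + 1)) v) \<and>
     (\<forall>\<Phi>\<in>W3 F N.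
        1 / \<tau> * L2ip (dom_of F) (\<lambda>x. bdf_gamma k *\<^sub>R B (n + 1) x - bdf_hat k B n x) \<Phi>
        + \<eta> * L2ip (dom_of F) (curl3 (B (n + 1))) (curl3 \<Phi>)
        - L2ip (dom_of F) (curl3 (\<lambda>x. cross3 (u (n + 1) x) (bdf_tilde k B n x))) \<Phi> = 0)
     \<longrightarrow>
     energy (dom_of F) k \<tau> \<mu> \<rho> u B (n + 1) - energy (dom_of F) k \<tau> \<mu> \<rho> u B n
     = - dissip (dom_of F) k \<tau> \<mu> \<rho> u B (n + 1)
       - \<nu> * grad_ip (dom_of F) (u (n + 1)) (u (n + 1))
       - \<eta> / (\<mu> * \<rho>) * L2sq (dom_of F) (curl3 (B (n + 1))))"
proof ((rule conjI; intro allI impI; elim conjE), goal_cases)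
  case (1 F N \<nu> \<eta> \<mu> \<rho> \<tau> k n u B f)
  \<comment> \<open>The case \<open>j = 0\<close> is the new time level; together with the history
    it gives the range \<open>{0..k}\<close>.\<close>
  have "u (n + 1 - j) \<in> U2 F N \<and> B (n + 1 - j) \<in> W2 F N" if "j \<in> {0..k}" for j
    using 1(10,11,12) that by (cases "j = 0") auto
  then show ?case
    by (intro energy_law_2D [where N = N and n = n and u = u and B = B, OF 1(1,8,9) _ _ 1(14) [unfolded 1(13)] 1(15)]) auto
next
  case (2 F N \<nu> \<eta> \<mu> \<rho> \<tau> k n u B f)
  have "u (n + 1 - j) \<in> U3 F N \<and> B (n + 1 - j) \<in> W3 F N" if "j \<in> {0..k}" for j
    using 2(10,11,12) that by (cases "j = 0") auto
  then show ?case
    by (intro energy_law_3D [where N = N and n = n and u = u and B = B, OF 2(1,8,9) _ _ 2(14) [unfolded 2(13)] 2(15)]) auto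
qed

end
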